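(* (Local efficiency of the element residual.) There is a constant $C>0$ independent of the mesh size such that for every $T\in\mathcal T_h$, $$h_T^2\,\|f+\nabla\cdot(\nabla_wu_h)-\lambda_h(u_h)\|^2_{L^2(T)}\le C\Big(\|\nabla u-\nabla_wu_h\|^2_{L^2(T)}+\mathrm{Osc}(f,T)^2+\|\lambda(u)-\lambda_h(u_h)\|^2_{H^{-1}(T)}\Big),$$ where $\mathrm{Osc}(f,T)=\big(h_T^2\|f-\bar f\|^2_{L^2(T)}\big)^{1/2}$ and $\bar f$ is the $L^2$-projection of $f$ onto the functions that are constant on each element of $\mathcal T_h$.
   Context: Continuous problem. $\Omega\subset\mathbb R^2$ is a bounded polygonal domain, assumed convex, with boundary $\Gamma$; $f\in L^2(\Omega)$; $\psi\in H^2(\Omega)$ with $\psi\le 0$ on $\Gamma$; $V=H^1_0(\Omega)$; $\mathcal K=\{v\in V: v\ge\psi \text{ a.e. in }\Omega\}$; $a(w,v)=\int_\Omega\nabla w\cdot\nabla v\,dx$, $L(v)=\int_\Omega fv\,dx$. $u\in\mathcal K$ is the unique solution of $a(u,v-u)\ge L(v-u)$ for all $v\in\mathcal K$. The continuous Lagrange multiplier $\lambda(u)\in H^{-1}(\Omega)$ is $(\lambda(u),v)_{-1,1}=L(v)-a(u,v)$ for $v\in V$, where $(\cdot,\cdot)_{-1,1}$ is the duality pairing of $H^{-1}(\Omega)$ and $H^1_0(\Omega)$. Mesh. $\mathcal T_h$ is a (conforming) triangulation of $\Omega$ from a shape-regular family, $h_T$ the diameter of $T$, $\mathcal E_h$ the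 set of all edges, $h_e$ the length of $e$. On an interior edge $e$ shared by $T_1,T_2$ with outward unit normals $\boldsymbol n_1=-\boldsymbol n_2$, $\{\!\{w\}\!\}=\frac12(w|_{T_1}+w|_{T_2})$ and $[\![w]\!]=w|_{T_1}\boldsymbol n_1+w|_{T_2}\boldsymbol n_2$ for scalar $w$; on a boundary edge $\{\!\{w\}\!\}=w$, $[\![w]\!]=w\boldsymbol n_e$ with $\boldsymbol n_e$ the outward unit normal. Discrete problem. $V_h^{0w}$ is the set of pairs $v_h=(v_h^0,v_h^b)$ with $v_h^0|_T\in\mathbb P_1(T)$ for all $T\in\mathcal T_h$ (no continuity imposed), $v_h^b|_e=\{\!\{v_h^0\}\!\}$ on interior edges, and $v_h^b=0$ on boundary edges. The discrete weak gradient $\nabla_w v_h|_T\in[\mathbb P_0(T)]^2$ is defined by $\int_T\nabla_w v_h\cdot\boldsymbol q\,dx=\int_{\partial T}\{\!\{v_h^0\}\!\}\boldsymbol q\cdot\boldsymbol n\,ds$ for all $\boldsymbol q\in[\mathbb P_0(T)]^2$. Set $a_h(w_h,v_h)=\sum_T\int_T\nabla_w w_h\cdot\nabla_w v_h\,dx+\sum_{e\in\mathcal E_h}\frac1{h_e}\int_e[\![w_h^0]\!]\cdot[\![v_h^0]\!]\,ds$, $L(v_h)=\sum_T\int_T f v_h^0\,dx$, and $\mathcal K_h=\{v_h\in V_h^{0w}:\int_T v_h^0\,dx\ge\int_T\psi\,dx\ \forall T\in\mathcal T_h\}$. $u_h\in\mathcal K_h$ is the unique solution of $a_h(u_h,v_h-u_h)\ge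 L(v_h-u_h)$ for all $v_h\in\mathcal K_h$. Discrete multiplier. $W_h$ is the space of functions that are constant on each $T$; $\pi_h^0v_h|_T=\frac1{|T|}\int_Tv_h^0\,dx$; the right inverse $\pi_h^{-1}:W_h\to V_h^{0w}$ sends $w_h$ to $(w_h,q_h^b)$ with $q_h^b=\{\!\{w_h\}\!\}$ on interior edges and $0$ on boundary edges. $\lambda_h(u_h)\in W_h$ is defined by $(\lambda_h(u_h),w_h)_{L^2(\Omega)}=L(\pi_h^{-1}w_h)-a_h(u_h,\pi_h^{-1}w_h)$ for all $w_h\in W_h$; it acts on $v\in V$ by $(\lambda_h(u_h),v)_{-1,1}=\int_\Omega\lambda_h(u_h)v\,dx$. For a functional on $H^1_0(\Omega)$ and open $D\subset\Omega$, $\|g\|_{H^{-1}(D)}=\sup_{0\ne\xi\in H^1_0(D)}g(\xi)/\|\xi\|_{H^1(D)}$, functions of $H^1_0(D)$ being extended by zero. *)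

theory Defs
  imports "HOL-Analysis.Analysis"
begin

type_synonym plane = "real^2"

section \<open>Sobolev spaces on open subsets of the plane\<close>

text \<open>Functions are total on the plane and only matter, up to null sets, on the domain \<open>D\<close>.\<close>

definition square_integrable :: "plane set \<Rightarrow> (plane \<Rightarrow> 'b::euclidean_space) \<Rightarrow> bool" where
  "square_integrable D g \<longleftrightarrow>
     g \<in> borel_measurable (lebesgue_on D) \<and> integrable (lebesgue_on D) (\<lambda>x. (norm (g x))\<^sup>2)"

definition L2_norm_on :: "plane set \<Rightarrow> (plane \<Rightarrow> 'b::euclidean_space) \<Rightarrow> real" where
  "L2_norm_on D g = sqrt (LINT x|lebesgue_on D. (norm (g x))\<^sup>2)"

definition gradient :: "(plane \<Rightarrow> real) \<Rightarrow> plane \<Rightarrow> plane" where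
  "gradient \<phi> x = (\<chi> i. frechet_derivative \<phi> (at x) (axis i 1))"

definition divergence :: "(plane \<Rightarrow> plane) \<Rightarrow> plane \<Rightarrow> real" where
  "divergence F x = (\<Sum>i\<in>UNIV. frechet_derivative F (at x) (axis i 1) $ i)"

primrec times_cont_differentiable :: "nat \<Rightarrow> (plane \<Rightarrow> real) \<Rightarrow> bool" where
  "times_cont_differentiable 0 \<phi> \<longleftrightarrow> continuous_on UNIV \<phi>"
| "times_cont_differentiable (Suc k) \<phi> \<longleftrightarrow>
     \<phi> differentiable_on UNIV \<and> (\<forall>i. times_cont_differentiable k (\<lambda>x. gradient \<phi> x $ i))"

definition test_function :: "plane set \<Rightarrow> (plane \<Rightarrow> real) \<Rightarrow> bool" where
  "test_function D \<phi> \<longleftrightarrow>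
     (\<forall>k. times_cont_differentiable k \<phi>) \<and>
     compact (closure {x. \<phi> x \<noteq> 0}) \<and> closure {x. \<phi> x \<noteq> 0} \<subseteq> D"

definition has_weak_gradient :: "plane set \<Rightarrow> (plane \<Rightarrow> real) \<Rightarrow> (plane \<Rightarrow> plane) \<Rightarrow> bool" where
  "has_weak_gradient D v G \<longleftrightarrow>
     square_integrable D v \<and> square_integrable D G \<and>
     (\<forall>\<phi>. test_function D \<phi> \<longrightarrow>
        (LINT x|lebesgue_on D. v x *\<^sub>R gradient \<phi> x) = - (LINT x|lebesgue_on D. \<phi> x *\<^sub>R G x))"

definition H1 :: "plane set \<Rightarrow> (plane \<Rightarrow> real) set" where
  "H1 D = {v. \<exists>G. has_weak_gradient D v G}"

text \<open>The weak gradient of an \<open>H1\<close> function is unique up to a null set; the choice is immaterial.\<close>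

definition weak_gradient :: "plane set \<Rightarrow> (plane \<Rightarrow> real) \<Rightarrow> plane \<Rightarrow> plane" where
  "weak_gradient D v = (SOME G. has_weak_gradient D v G)"

definition H2 :: "plane set \<Rightarrow> (plane \<Rightarrow> real) set" where
  "H2 D = {v \<in> H1 D. \<forall>i. (\<lambda>x. weak_gradient D v x $ i) \<in> H1 D}"

definition H1_norm :: "plane set \<Rightarrow> (plane \<Rightarrow> real) \<Rightarrow> real" where
  "H1_norm D v = sqrt ((L2_norm_on D v)\<^sup>2 + (L2_norm_on D (weak_gradient D v))\<^sup>2)"

definition H10 :: "plane set \<Rightarrow> (plane \<Rightarrow> real) set" where
  "H10 D = {v \<in> H1 D. \<exists>\<phi>. (\<forall>n::nat. test_function D (\<phi> n)) \<and>
                          (\<lambda>n. H1_norm D (\<lambda>x. v x - \<phi> n x)) \<longlonglongrightarrow> 0}"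

text \<open>\<open>g\<close> is a functional on \<open>H10 \<Omega>\<close> with \<open>D \<subseteq> \<Omega>\<close>. The supremum is a real one, so it is
  meaningful for functionals that are bounded on \<open>H10 D\<close>.\<close>

definition H_minus1_norm :: "plane set \<Rightarrow> ((plane \<Rightarrow> real) \<Rightarrow> real) \<Rightarrow> real" where
  "H_minus1_norm D g =
     Sup {g (\<lambda>x. if x \<in> D then \<xi> x else 0) / H1_norm D \<xi> | \<xi>. \<xi> \<in> H10 D \<and> H1_norm D \<xi> \<noteq> 0}"

section \<open>The obstacle problem\<close>

definition convex_polygonal_domain :: "plane set \<Rightarrow> bool" where
  "convex_polygonal_domain \<Omega> \<longleftrightarrow> open \<Omega> \<and> convex \<Omega> \<and> \<Omega> \<noteq> {} \<and> polytope (closure \<Omega>)"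

text \<open>Boundary values of an \<open>H2\<close> function are those of its continuous representative
  (Sobolev embedding in dimension two).\<close>

definition nonpos_on_boundary :: "plane set \<Rightarrow> (plane \<Rightarrow> real) \<Rightarrow> bool" where
  "nonpos_on_boundary \<Omega> \<psi> \<longleftrightarrow>
     (\<exists>g. continuous_on (closure \<Omega>) g \<and> (AE x in lebesgue_on \<Omega>. \<psi> x = g x) \<and>
          (\<forall>x\<in>frontier \<Omega>. g x \<le> 0))"

definition a_form :: "plane set \<Rightarrow> (plane \<Rightarrow> real) \<Rightarrow> (plane \<Rightarrow> real) \<Rightarrow> real" where
  "a_form \<Omega> w v = (LINT x|lebesgue_on \<Omega>. weak_gradient \<Omega> w x \<bullet> weak_gradient \<Omega> v x)"

definition load :: "plane set \<Rightarrow> (plane \<Rightarrow> real) \<Rightarrow> (plane \<Rightarrow> real) \<Rightarrow> real" where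
  "load \<Omega> f v = (LINT x|lebesgue_on \<Omega>. f x * v x)"

definition admissible :: "plane set \<Rightarrow> (plane \<Rightarrow> real) \<Rightarrow> (plane \<Rightarrow> real) set" where
  "admissible \<Omega> \<psi> = {v \<in> H10 \<Omega>. AE x in lebesgue_on \<Omega>. v x \<ge> \<psi> x}"

definition solves_obstacle ::
  "plane set \<Rightarrow> (plane \<Rightarrow> real) \<Rightarrow> (plane \<Rightarrow> real) \<Rightarrow> (plane \<Rightarrow> real) \<Rightarrow> bool" where
  "solves_obstacle \<Omega> f \<psi> u \<longleftrightarrow>
     u \<in> admissible \<Omega> \<psi> \<and>
     (\<forall>v\<in>admissible \<Omega> \<psi>. a_form \<Omega> u (\<lambda>x. v x - u x) \<ge> load \<Omega> f (\<lambda>x. v x - u x))"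

definition multiplier ::
  "plane set \<Rightarrow> (plane \<Rightarrow> real) \<Rightarrow> (plane \<Rightarrow> real) \<Rightarrow> (plane \<Rightarrow> real) \<Rightarrow> real" where
  "multiplier \<Omega> f u v = load \<Omega> f v - a_form \<Omega> u v"

section \<open>Meshes\<close>

text \<open>The library's \<open>triangulation\<close> is conforming: two cells meet in a common face.\<close>

definition mesh_of :: "plane set \<Rightarrow> plane set set \<Rightarrow> bool" where
  "mesh_of \<Omega> \<T> \<longleftrightarrow> triangulation \<T> \<and> (\<forall>T\<in>\<T>. 2 simplex T) \<and> \<Union>\<T> = closure \<Omega>"

definition inradius :: "plane set \<Rightarrow> real" where
  "inradius T = Sup {r. \<exists>x. cball x r \<subseteq> T}"

definition shape_regular_family :: "plane set \<Rightarrow> plane set set set \<Rightarrow> bool" where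
  "shape_regular_family \<Omega> F \<longleftrightarrow>
     (\<forall>\<T>\<in>F. mesh_of \<Omega> \<T>) \<and>
     (\<exists>\<sigma>>0. \<forall>\<T>\<in>F. \<forall>T\<in>\<T>. diameter T \<le> \<sigma> * inradius T)"

definition edges :: "plane set set \<Rightarrow> plane set set" where
  "edges \<T> = {e. \<exists>T\<in>\<T>. e edge_of T}"

definition boundary_edges :: "plane set \<Rightarrow> plane set set \<Rightarrow> plane set set" where
  "boundary_edges \<Omega> \<T> = {e \<in> edges \<T>. e \<subseteq> frontier \<Omega>}"

definition interior_edges :: "plane set \<Rightarrow> plane set set \<Rightarrow> plane set set" where
  "interior_edges \<Omega> \<T> = edges \<T> - boundary_edges \<Omega> \<T>"

text \<open>The arc-length integral; both orientations of the segment give the same value.\<close>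

definition edge_integral :: "plane set \<Rightarrow> (plane \<Rightarrow> real) \<Rightarrow> real" where
  "edge_integral e g =
     (let (a, b) = (SOME (a, b). e = closed_segment a b)
      in dist a b * integral {0..1} (\<lambda>t. g (linepath a b t)))"

definition outward_normal :: "plane set \<Rightarrow> plane set \<Rightarrow> plane" where
  "outward_normal T e =
     (THE n. norm n = 1 \<and> (\<forall>x\<in>e. \<forall>y\<in>e. n \<bullet> (y - x) = 0) \<and> (\<forall>x\<in>e. \<forall>y\<in>T. n \<bullet> (y - x) \<le> 0))"

section \<open>Discontinuous piecewise polynomial functions\<close>

text \<open>A broken function gives on each element \<open>T\<close> a function \<open>w T\<close>, so that its one-sided
  traces on edges are available; only the values of \<open>w T\<close> on \<open>T\<close> matter.\<close>

type_synonym broken = "plane set \<Rightarrow> plane \<Rightarrow> real"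

text \<open>An edge has two adjacent elements if it is interior and one if it lies on the boundary, so
  the two formulas below cover both cases of the usual definitions.\<close>

definition average :: "plane set set \<Rightarrow> broken \<Rightarrow> plane set \<Rightarrow> plane \<Rightarrow> real" where
  "average \<T> w e x = (\<Sum>T | T \<in> \<T> \<and> e edge_of T. w T x) / real (card {T \<in> \<T>. e edge_of T})"

definition jump :: "plane set set \<Rightarrow> broken \<Rightarrow> plane set \<Rightarrow> plane \<Rightarrow> plane" where
  "jump \<T> w e x = (\<Sum>T | T \<in> \<T> \<and> e edge_of T. w T x *\<^sub>R outward_normal T e)"

text \<open>Weak functions: an interior part (indexed by elements) and an edge part (indexed by edges).\<close>

type_synonym weak_fun = "broken \<times> (plane set \<Rightarrow> plane \<Rightarrow> real)"

definition V_h :: "plane set \<Rightarrow> plane set set \<Rightarrow> weak_fun set" where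
  "V_h \<Omega> \<T> = {(v0, vb).
     (\<forall>T\<in>\<T>. \<exists>c d. \<forall>x\<in>T. v0 T x = c + d \<bullet> x) \<and>
     (\<forall>e\<in>interior_edges \<Omega> \<T>. \<forall>x\<in>e. vb e x = average \<T> v0 e x) \<and>
     (\<forall>e\<in>boundary_edges \<Omega> \<T>. \<forall>x\<in>e. vb e x = 0)}"

text \<open>The constant value of the discrete weak gradient on the element \<open>T\<close>.\<close>

definition discrete_weak_gradient :: "plane set set \<Rightarrow> weak_fun \<Rightarrow> plane set \<Rightarrow> plane" where
  "discrete_weak_gradient \<T> v T =
     (THE g. \<forall>q. (LINT x|lebesgue_on T. g \<bullet> q) =
        (\<Sum>e | e edge_of T. edge_integral e (\<lambda>x. average \<T> (fst v) e x * (q \<bullet> outward_normal T e))))"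

definition a_h :: "plane set set \<Rightarrow> weak_fun \<Rightarrow> weak_fun \<Rightarrow> real" where
  "a_h \<T> w v =
     (\<Sum>T\<in>\<T>. LINT x|lebesgue_on T. discrete_weak_gradient \<T> w T \<bullet> discrete_weak_gradient \<T> v T)
     + (\<Sum>e\<in>edges \<T>. 1 / diameter e *
          edge_integral e (\<lambda>x. jump \<T> (fst w) e x \<bullet> jump \<T> (fst v) e x))"

definition load_h :: "plane set set \<Rightarrow> (plane \<Rightarrow> real) \<Rightarrow> weak_fun \<Rightarrow> real" where
  "load_h \<T> f v = (\<Sum>T\<in>\<T>. LINT x|lebesgue_on T. f x * fst v T x)"

definition admissible_h :: "plane set \<Rightarrow> plane set set \<Rightarrow> (plane \<Rightarrow> real) \<Rightarrow> weak_fun set" where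
  "admissible_h \<Omega> \<T> \<psi> =
     {v \<in> V_h \<Omega> \<T>. \<forall>T\<in>\<T>. (LINT x|lebesgue_on T. fst v T x) \<ge> (LINT x|lebesgue_on T. \<psi> x)}"

definition solves_obstacle_h ::
  "plane set \<Rightarrow> plane set set \<Rightarrow> (plane \<Rightarrow> real) \<Rightarrow> (plane \<Rightarrow> real) \<Rightarrow> weak_fun \<Rightarrow> bool" where
  "solves_obstacle_h \<Omega> \<T> f \<psi> u\<^sub>h \<longleftrightarrow>
     u\<^sub>h \<in> admissible_h \<Omega> \<T> \<psi> \<and>
     (\<forall>v\<^sub>h\<in>admissible_h \<Omega> \<T> \<psi>. a_h \<T> u\<^sub>h (v\<^sub>h - u\<^sub>h) \<ge> load_h \<T> f (v\<^sub>h - u\<^sub>h))"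

definition W_h :: "plane set set \<Rightarrow> broken set" where
  "W_h \<T> = {w. \<forall>T\<in>\<T>. \<exists>c. \<forall>x\<in>T. w T x = c}"

definition pi_right_inverse :: "plane set \<Rightarrow> plane set set \<Rightarrow> broken \<Rightarrow> weak_fun" where
  "pi_right_inverse \<Omega> \<T> w =
     (w, \<lambda>e x. if e \<in> boundary_edges \<Omega> \<T> then 0 else average \<T> w e x)"

definition discrete_multiplier ::
  "plane set \<Rightarrow> plane set set \<Rightarrow> (plane \<Rightarrow> real) \<Rightarrow> weak_fun \<Rightarrow> broken \<Rightarrow> bool" where
  "discrete_multiplier \<Omega> \<T> f u\<^sub>h \<mu> \<longleftrightarrow>
     \<mu> \<in> W_h \<T> \<and>
     (\<forall>w\<in>W_h \<T>. (\<Sum>T\<in>\<T>. LINT x|lebesgue_on T. \<mu> T x * w T x) =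
        load_h \<T> f (pi_right_inverse \<Omega> \<T> w) - a_h \<T> u\<^sub>h (pi_right_inverse \<Omega> \<T> w))"

text \<open>A broken function as a functional on functions on the domain.\<close>

definition broken_functional :: "plane set set \<Rightarrow> broken \<Rightarrow> (plane \<Rightarrow> real) \<Rightarrow> real" where
  "broken_functional \<T> \<mu> v = (\<Sum>T\<in>\<T>. LINT x|lebesgue_on T. \<mu> T x * v x)"

definition L2_projection :: "plane set set \<Rightarrow> (plane \<Rightarrow> real) \<Rightarrow> broken \<Rightarrow> bool" where
  "L2_projection \<T> f fbar \<longleftrightarrow>
     fbar \<in> W_h \<T> \<and>
     (\<forall>w\<in>W_h \<T>. (\<Sum>T\<in>\<T>. LINT x|lebesgue_on T. (f x - fbar T x) * w T x) = 0)"

definition oscillation :: "(plane \<Rightarrow> real) \<Rightarrow> broken \<Rightarrow> plane set \<Rightarrow> real" where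
  "oscillation f fbar T = sqrt ((diameter T)\<^sup>2 * (L2_norm_on T (\<lambda>x. f x - fbar T x))\<^sup>2)"

end

theory Submission
  imports Defs
begin

text \<open>The mechanism is Verfuerth's bubble argument. The discrete weak gradient is constant on \<open>T\<close>, so
  its divergence vanishes, and the discrete multiplier is a constant \<open>c\<close> on \<open>T\<close>; the residual is \<open>f - c\<close>. Writing
  \<open>b\<close> for the constant value of the projection of \<open>f\<close>, the residual is \<open>(f - b) + k\<close> with \<open>k = b - c\<close>. The
  first summand is the oscillation, so only the number \<open>k\<close> has to be bounded.

  For \<open>\<xi>\<close> in \<open>H10\<close> of the interior of \<open>T\<close>, extended by zero, the definition of the continuous multiplier
  gives
  \<open>(\<lambda>(u) - \<lambda>\<^sub>h, \<xi>) = \<integral>(f - c) \<xi> - \<integral>\<nabla>u \<bullet> \<nabla>\<xi>\<close> (\<open>multiplier_error_eq\<close>). As \<open>\<nabla>\<xi>\<close> has mean zero, any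
  constant vector \<open>g\<close> may be subtracted from \<open>\<nabla>u\<close>, in particular the discrete weak gradient. Taking
  \<open>\<xi> = k \<eta>\<close> with a bubble \<open>\<eta>\<close> yields
  \<open>k\<^sup>2 \<integral>\<eta> = (\<lambda>(u) - \<lambda>\<^sub>h, \<xi>) - \<integral>(f - b) \<xi> + \<integral>(\<nabla>u - g) \<bullet> \<nabla>\<xi>\<close>,
  and each term on the right is at most one of the three error quantities times a norm of \<open>\<xi>\<close>
  (\<open>constant_residual_bound\<close>). The bubble lives on a cube of half side \<open>\<rho>\<close> inside \<open>T\<close>, and
  \<open>\<integral>\<eta> \<ge> exp (- 8) * \<rho>\<^sup>2\<close>, \<open>\<parallel>\<eta>\<parallel> \<le> 2 * \<rho>\<close>, \<open>\<parallel>\<nabla>\<eta>\<parallel> \<le> 16\<close>. Shape regularity makes \<open>\<rho>\<close> comparable with the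
  diameter of \<open>T\<close>, which gives the scaling in the theorem. Since the dual norm is taken with respect to
  the full \<open>H1\<close> norm, the constant also depends on the diameter of \<open>\<Omega>\<close>.

  A smooth bubble is preferred to the usual product of barycentric coordinates: being a test function it
  belongs to \<open>H10\<close> without any approximation, and the same family of bumps proves the fundamental lemma
  of the calculus of variations. That lemma is what makes the chosen weak gradients computable: it
  identifies the weak gradient of a test function with the classical one, and that of a zero extension
  with the zero extension of the weak gradient (\<open>H10_zero_extension\<close>). The latter also shows that the
  multiplier error is bounded on \<open>H10\<close> of the element, without which the supremum defining the dual norm
  would give no inequality (\<open>multiplier_error_le_dual_norm\<close>).\<close>

section \<open>Smooth bumps on boxes\<close>

text \<open>The weights \<open>(1 / t) ^ n\<close> make the family closed under differentiation up to linear combinations, so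
  that smoothness at \<open>0\<close> needs only one limit.\<close>

definition flat_exp :: "nat \<Rightarrow> real \<Rightarrow> real" where
  "flat_exp n t = (if t > 0 then (1 / t) ^ n * exp (- (1 / t)) else 0)"

lemma flat_exp_tendsto_0: "(flat_exp n \<longlongrightarrow> 0) (at 0)"
proof -
  have "((\<lambda>t::real. (1/t) ^ n / exp (1/t)) \<longlongrightarrow> 0) (at_right 0)"
  proof (rule filterlim_compose[OF tendsto_power_div_exp_0])
    show "filterlim (\<lambda>t::real. 1/t) at_top (at_right 0)"
      using filterlim_inverse_at_top_right by (simp add: inverse_eq_divide)
  qed
  then have r: "(flat_exp n \<longlongrightarrow> 0) (at_right 0)"
    by (rule Lim_transform_eventually)
       (auto simp: flat_exp_def exp_minus divide_inverse eventually_at_right_less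
          intro!: eventually_mono[OF eventually_at_right_less])
  have l: "(flat_exp n \<longlongrightarrow> 0) (at_left 0)"
    by (rule tendsto_eventually) (auto simp: flat_exp_def eventually_at_left_field intro: exI[of _ "-1"])
  show ?thesis using l r by (simp add: filterlim_split_at)
qed

lemma flat_exp_has_derivative:
  "(flat_exp n has_real_derivative flat_exp (n + 2) t - real n * flat_exp (n + 1) t) (at t)"
proof -
  consider "t > 0" | "t < 0" | "t = 0" by linarith
  then show ?thesis
  proof cases
    case 1
    have "((\<lambda>t. (1 / t) ^ n * exp (- (1 / t))) has_real_derivative
            flat_exp (n + 2) t - real n * flat_exp (n + 1) t) (at t)"
      using 1 by (auto intro!: derivative_eq_intros simp: flat_exp_def field_simps power2_eq_square)
        (cases n; simp add: field_simps power2_eq_square)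
    then show ?thesis
      by (rule has_field_derivative_transform_within_open[of _ _ _ "{0<..}"]) (use 1 in \<open>auto simp: flat_exp_def\<close>)
  next
    case 2
    have "((\<lambda>t. 0) has_real_derivative 0) (at t)" by simp
    then have "(flat_exp n has_real_derivative 0) (at t)"
      by (rule has_field_derivative_transform_within_open[of _ _ _ "{..<0}"]) (use 2 in \<open>auto simp: flat_exp_def\<close>)
    then show ?thesis using 2 by (simp add: flat_exp_def)
  next
    case 3
    have "((\<lambda>y. (flat_exp n y - flat_exp n 0) / (y - 0)) \<longlongrightarrow> 0) (at 0)"
      by (rule Lim_transform_eventually[OF flat_exp_tendsto_0[of "Suc n"]])
         (auto simp: flat_exp_def eventually_at_filter)
    then show ?thesis using 3 by (simp add: has_field_derivative_iff flat_exp_def)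
  qed
qed

lemma flat_exp_nonneg: "0 \<le> flat_exp n t"
  by (simp add: flat_exp_def)

lemma flat_exp_0_le_1: "flat_exp 0 t \<le> 1"
  by (simp add: flat_exp_def)

text \<open>The derivative of \<open>flat_exp 0\<close> is \<open>flat_exp 2\<close>; this is the bound that controls the gradients of all
  bumps.\<close>

lemma flat_exp_2_le_2: "flat_exp 2 t \<le> 2"
proof (cases "t > 0")
  case True
  define s where "s = 1/t"
  have "1 + s + s\<^sup>2/2 \<le> exp s"
    by (rule exp_lower_Taylor_quadratic) (use True in \<open>simp add: s_def\<close>)
  moreover have "s > 0" using True by (simp add: s_def)
  ultimately have "s\<^sup>2 \<le> 2 * exp s" by linarith
  then have "s\<^sup>2 * exp (-s) \<le> 2" by (simp add: exp_minus field_simps)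
  then show ?thesis using True by (simp add: flat_exp_def s_def)
qed (simp add: flat_exp_def)

lemma has_derivative_gradient:
  assumes "\<phi> differentiable at x"
  shows "(\<phi> has_derivative (\<lambda>h. gradient \<phi> x \<bullet> h)) (at x)"
proof -
  obtain D where D: "(\<phi> has_derivative D) (at x)" using assms differentiable_def by blast
  have fD: "frechet_derivative \<phi> (at x) = D" using D frechet_derivative_at by metis
  interpret bounded_linear D using D has_derivative_bounded_linear by blast
  have "D h = gradient \<phi> x \<bullet> h" for h
  proof -
    have "D h = D (\<Sum>i\<in>UNIV. (h $ i) *\<^sub>R axis i 1)"
      by (metis basis_expansion scalar_mult_eq_scaleR)
    also have "\<dots> = (\<Sum>i\<in>UNIV. (h $ i) * D (axis i 1))" by (simp add: sum scaleR)
    also have "\<dots> = gradient \<phi> x \<bullet> h" by (simp add: inner_vec_def gradient_def fD mult.commute)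
    finally show ?thesis .
  qed
  then have "D = (\<lambda>h. gradient \<phi> x \<bullet> h)" by auto
  then show ?thesis using D by simp
qed

lemma gradient_component:
  assumes "(\<phi> has_derivative D) (at x)"
  shows "gradient \<phi> x $ i = D (axis i 1)"
  using frechet_derivative_at[OF assms] by (simp add: gradient_def)

text \<open>An inductively generated class that contains the partial derivatives of its members, so that differentiability alone
  already gives smoothness of every order.\<close>

inductive bump_expr :: "(plane \<Rightarrow> real) \<Rightarrow> bool" where
  flat: "bump_expr (\<lambda>x. flat_exp n (\<alpha> * x $ i + \<beta>))"
| const: "bump_expr (\<lambda>_. c)"
| add: "bump_expr g \<Longrightarrow> bump_expr h \<Longrightarrow> bump_expr (\<lambda>x. g x + h x)"
| mult: "bump_expr g \<Longrightarrow> bump_expr h \<Longrightarrow> bump_expr (\<lambda>x. g x * h x)"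

lemma flat_affine_has_derivative:
  "((\<lambda>x. flat_exp n (\<alpha> * x $ i + \<beta>)) has_derivative
     (\<lambda>h. (flat_exp (n + 2) (\<alpha> * x $ i + \<beta>) - real n * flat_exp (n + 1) (\<alpha> * x $ i + \<beta>)) * (\<alpha> * h $ i))) (at x)"
proof -
  have "((\<lambda>x. \<alpha> * x $ i + \<beta>) has_derivative (\<lambda>h. \<alpha> * h $ i)) (at x)"
    by (auto intro!: derivative_eq_intros bounded_linear.has_derivative[OF bounded_linear_vec_nth])
  from has_derivative_compose[OF this flat_exp_has_derivative[unfolded has_field_derivative_def]]
  show ?thesis .
qed

lemma bump_expr_gradient:
  assumes "bump_expr \<phi>"
  shows "(\<forall>x. \<phi> differentiable at x) \<and> (\<forall>i. bump_expr (\<lambda>x. gradient \<phi> x $ i))"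
  using assms
proof induction
  case (flat n \<alpha> i \<beta>)
  have "bump_expr (\<lambda>x. gradient (\<lambda>x. flat_exp n (\<alpha> * x $ i + \<beta>)) x $ j)" for j
  proof -
    have eq: "gradient (\<lambda>x. flat_exp n (\<alpha> * x $ i + \<beta>)) x $ j =
      (\<alpha> * axis j 1 $ i) * flat_exp (n + 2) (\<alpha> * x $ i + \<beta>) +
      (- (\<alpha> * axis j 1 $ i) * real n) * flat_exp (n + 1) (\<alpha> * x $ i + \<beta>)" for x :: plane
      by (subst gradient_component[OF flat_affine_has_derivative]) (simp add: algebra_simps)
    show ?thesis unfolding eq
      by (intro bump_expr.intros)
  qed
  then show ?case using flat_affine_has_derivative differentiable_def by blast
next
  case (const c)
  have "gradient (\<lambda>_. c) x $ i = 0" for x i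
    by (subst gradient_component[OF has_derivative_const]) simp
  then show ?case by (auto intro: bump_expr.const)
next
  case (add g h)
  have "((\<lambda>x. g x + h x) has_derivative (\<lambda>v. gradient g x \<bullet> v + gradient h x \<bullet> v)) (at x)" for x
    using add by (intro has_derivative_add has_derivative_gradient) auto
  from gradient_component[OF this]
  have "gradient (\<lambda>x. g x + h x) x $ i = gradient g x $ i + gradient h x $ i" for x i
    by (simp add: inner_axis)
  then show ?case using add by (auto intro: bump_expr.add)
next
  case (mult g h)
  have "((\<lambda>x. g x * h x) has_derivative (\<lambda>v. g x * (gradient h x \<bullet> v) + (gradient g x \<bullet> v) * h x)) (at x)" for x
    using mult by (intro has_derivative_mult has_derivative_gradient) auto
  from gradient_component[OF this]
  have "gradient (\<lambda>x. g x * h x) x $ i = g x * gradient h x $ i + gradient g x $ i * h x" for x i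
    by (simp add: inner_axis)
  then show ?case using mult by (auto intro!: bump_expr.add bump_expr.mult)
qed

lemma bump_expr_smooth: "bump_expr \<phi> \<Longrightarrow> times_cont_differentiable k \<phi>"
proof (induction k arbitrary: \<phi>)
  case 0
  then show ?case
    using bump_expr_gradient[OF 0] differentiable_imp_continuous_within
    by (auto simp: continuous_on_eq_continuous_at)
next
  case (Suc k)
  then show ?case using bump_expr_gradient[OF Suc.prems] by (auto simp: differentiable_on_def)
qed

lemma bump_expr_scale: "bump_expr \<phi> \<Longrightarrow> bump_expr (\<lambda>x. c * \<phi> x)"
  by (intro bump_expr.intros)

text \<open>A smooth function that is positive exactly on an open box. For \<open>s\<close> tending to infinity it increases to the
  indicator of the box; for \<open>s\<close> the inverse of half the side length of a cube its lower bounds near the centre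
  do not depend on the size of the cube.\<close>

definition box_bump :: "real \<Rightarrow> plane \<Rightarrow> plane \<Rightarrow> plane \<Rightarrow> real" where
  "box_bump s a b x = (\<Prod>i\<in>UNIV. flat_exp 0 (s * (x $ i - a $ i)) * flat_exp 0 (s * (b $ i - x $ i)))"

lemma bump_expr_box_bump: "bump_expr (box_bump s a b)"
proof -
  have eq: "box_bump s a b = (\<lambda>x. (flat_exp 0 (s * x $ 1 + (- (s * a $ 1))) * flat_exp 0 ((- s) * x $ 1 + s * b $ 1))
      * (flat_exp 0 (s * x $ 2 + (- (s * a $ 2))) * flat_exp 0 ((- s) * x $ 2 + s * b $ 2)))"
    by (rule ext) (simp add: box_bump_def UNIV_2 algebra_simps)
  show ?thesis unfolding eq by (intro bump_expr.intros)
qed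

lemma box_bump_zero_iff: "s > 0 \<Longrightarrow> box_bump s a b x = 0 \<longleftrightarrow> x \<notin> box a b"
  by (auto simp: box_bump_def flat_exp_def mem_box_cart zero_less_mult_iff)

lemma box_bump_bounds: "0 \<le> box_bump s a b x" "box_bump s a b x \<le> 1"
  by (auto simp: box_bump_def flat_exp_nonneg flat_exp_0_le_1 intro!: prod_nonneg prod_le_1 mult_le_one)

lemma test_function_box_bump:
  assumes "s > 0" "cbox a b \<subseteq> D"
  shows "test_function D (\<lambda>x. c * box_bump s a b x)"
proof -
  have "closure {x. c * box_bump s a b x \<noteq> 0} \<subseteq> cbox a b"
    using box_subset_cbox[of a b]
    by (intro closure_minimal) (auto simp: box_bump_zero_iff[OF assms(1)])
  then show ?thesis
    unfolding test_function_def
    using assms(2) bump_expr_smooth[OF bump_expr_scale[OF bump_expr_box_bump]]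
    by (meson bounded_cbox bounded_subset closed_closure compact_eq_bounded_closed order_trans)
qed

lemma box_bump_tendsto: "(\<lambda>n. box_bump (real (Suc n)) a b x) \<longlonglongrightarrow> indicator (box a b) x"
proof (cases "x \<in> box a b")
  case True
  have t: "(\<lambda>n. flat_exp 0 (real (Suc n) * t)) \<longlonglongrightarrow> 1" if "t > 0" for t
  proof -
    have "(\<lambda>n. exp (- (inverse (real (Suc n)) * (1/t)))) \<longlonglongrightarrow> exp (- (0 * (1/t)))"
      by (intro tendsto_intros LIMSEQ_inverse_real_of_nat)
    moreover have "exp (- (inverse (real (Suc n)) * (1/t))) = flat_exp 0 (real (Suc n) * t)" for n
      using that by (simp add: flat_exp_def zero_less_mult_iff inverse_eq_divide)
    ultimately show ?thesis by simp
  qed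
  have "(\<lambda>n. box_bump (real (Suc n)) a b x) \<longlonglongrightarrow> (\<Prod>i\<in>(UNIV::2 set). 1 * 1)"
    unfolding box_bump_def
    by (intro tendsto_prod tendsto_mult t) (use True in \<open>auto simp: mem_box_cart\<close>)
  then show ?thesis using True by simp
next
  case False
  then show ?thesis using box_bump_zero_iff[of "real (Suc _)" a b x] by simp
qed

section \<open>Square integrable functions\<close>

lemma norm_mult_integrable:
  assumes "square_integrable D f" "square_integrable D g"
  shows "integrable (lebesgue_on D) (\<lambda>x. norm (f x) * norm (g x))"
proof -
  have b: "norm (f x) * norm (g x) \<le> (norm (f x))\<^sup>2 + (norm (g x))\<^sup>2" for x
  proof -
    have "0 \<le> norm (f x) * norm (g x)" by simp
    then show ?thesis using sum_squares_bound[of "norm (f x)" "norm (g x)"] by linarith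
  qed
  have [measurable]: "f \<in> borel_measurable (lebesgue_on D)" "g \<in> borel_measurable (lebesgue_on D)"
    using assms by (auto simp: square_integrable_def)
  have I: "integrable (lebesgue_on D) (\<lambda>x. (norm (f x))\<^sup>2 + (norm (g x))\<^sup>2)"
    using assms by (auto simp: square_integrable_def)
  show ?thesis
    by (rule Bochner_Integration.integrable_bound[OF I]) (use b in auto)
qed

lemma inner_integrable:
  assumes "square_integrable D f" "square_integrable D g"
  shows "integrable (lebesgue_on D) (\<lambda>x. f x \<bullet> g x)"
proof -
  have [measurable]: "f \<in> borel_measurable (lebesgue_on D)" "g \<in> borel_measurable (lebesgue_on D)"
    using assms by (auto simp: square_integrable_def)
  show ?thesis
    by (rule Bochner_Integration.integrable_bound[OF norm_mult_integrable[OF assms]]) (auto simp: Cauchy_Schwarz_ineq2)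
qed

lemma scaleR_integrable:
  assumes "square_integrable D f" "square_integrable D g"
  shows "integrable (lebesgue_on D) (\<lambda>x. f x *\<^sub>R g x)"
proof -
  have [measurable]: "f \<in> borel_measurable (lebesgue_on D)" "g \<in> borel_measurable (lebesgue_on D)"
    using assms by (auto simp: square_integrable_def)
  show ?thesis
    by (rule Bochner_Integration.integrable_bound[OF norm_mult_integrable[OF assms]]) auto
qed

lemma L2_norm_on_nonneg: "0 \<le> L2_norm_on D f"
  by (simp add: L2_norm_on_def)

lemma L2_norm_on_square: "(L2_norm_on D f)\<^sup>2 = (LINT x|lebesgue_on D. (norm (f x))\<^sup>2)"
  by (simp add: L2_norm_on_def)

text \<open>Young's inequality with the weights \<open>b / a\<close> and \<open>a / b\<close>, where \<open>a\<close> and \<open>b\<close> are the two norms. Both are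
  enlarged by \<open>\<epsilon>\<close> to treat vanishing norms at the same time.\<close>

lemma Cauchy_Schwarz_norm:
  assumes "square_integrable D f" "square_integrable D g"
  shows "(LINT x|lebesgue_on D. norm (f x) * norm (g x)) \<le> L2_norm_on D f * L2_norm_on D g"
proof -
  let ?P = "LINT x|lebesgue_on D. norm (f x) * norm (g x)"
  have I: "integrable (lebesgue_on D) (\<lambda>x. (norm (f x))\<^sup>2)" "integrable (lebesgue_on D) (\<lambda>x. (norm (g x))\<^sup>2)"
    using assms by (auto simp: square_integrable_def)
  have bound: "?P \<le> (L2_norm_on D f + \<epsilon>) * (L2_norm_on D g + \<epsilon>)" if "\<epsilon> > 0" for \<epsilon>
  proof -
    define a b where "a = L2_norm_on D f + \<epsilon>" and "b = L2_norm_on D g + \<epsilon>"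
    have ab: "a > 0" "b > 0" using that L2_norm_on_nonneg[of D f] L2_norm_on_nonneg[of D g] by (auto simp: a_def b_def)
    have "?P \<le> (LINT x|lebesgue_on D. (b / (2 * a)) * (norm (f x))\<^sup>2 + (a / (2 * b)) * (norm (g x))\<^sup>2)"
    proof (rule integral_mono)
      show "integrable (lebesgue_on D) (\<lambda>x. (b / (2 * a)) * (norm (f x))\<^sup>2 + (a / (2 * b)) * (norm (g x))\<^sup>2)"
        using I by (intro Bochner_Integration.integrable_add integrable_mult_right)
      show "norm (f x) * norm (g x) \<le> (b / (2 * a)) * (norm (f x))\<^sup>2 + (a / (2 * b)) * (norm (g x))\<^sup>2" for x
        using ab sum_squares_bound[of "b * norm (f x)" "a * norm (g x)"]
        by (simp add: field_simps power2_eq_square)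
    qed (rule norm_mult_integrable[OF assms])
    also have "\<dots> = (b / (2 * a)) * (L2_norm_on D f)\<^sup>2 + (a / (2 * b)) * (L2_norm_on D g)\<^sup>2"
      using I by (simp add: L2_norm_on_square)
    also have "\<dots> \<le> (b / (2 * a)) * a\<^sup>2 + (a / (2 * b)) * b\<^sup>2"
      using ab that L2_norm_on_nonneg[of D f] L2_norm_on_nonneg[of D g]
      by (intro add_mono mult_left_mono power_mono) (auto simp: a_def b_def)
    also have "\<dots> = a * b" using ab by (simp add: field_simps power2_eq_square)
    finally show ?thesis by (simp add: a_def b_def)
  qed
  have "((\<lambda>\<epsilon>. (L2_norm_on D f + \<epsilon>) * (L2_norm_on D g + \<epsilon>)) \<longlongrightarrow> (L2_norm_on D f + 0) * (L2_norm_on D g + 0)) (at_right 0)"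
    by (intro tendsto_intros)
  from tendsto_lowerbound[OF this, of ?P] show ?thesis
    using bound by (simp add: eventually_at_right_less eventually_mono[OF eventually_at_right_less])
qed

lemma Cauchy_Schwarz_inner:
  assumes "square_integrable D f" "square_integrable D g"
  shows "\<bar>LINT x|lebesgue_on D. f x \<bullet> g x\<bar> \<le> L2_norm_on D f * L2_norm_on D g"
proof -
  have "\<bar>LINT x|lebesgue_on D. f x \<bullet> g x\<bar> \<le> (LINT x|lebesgue_on D. norm (f x) * norm (g x))"
    by (rule order_trans[OF integral_abs_bound])
       (auto intro!: integral_mono integrable_abs inner_integrable norm_mult_integrable assms simp: Cauchy_Schwarz_ineq2)
  then show ?thesis using Cauchy_Schwarz_norm[OF assms] by linarith
qed

lemma norm_integral_scaleR_le:
  assumes "square_integrable D f" "square_integrable D g"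
  shows "norm (LINT x|lebesgue_on D. f x *\<^sub>R g x) \<le> L2_norm_on D f * L2_norm_on D g"
  using integral_norm_bound[of "lebesgue_on D" "\<lambda>x. f x *\<^sub>R g x"] Cauchy_Schwarz_norm[OF assms]
  by simp

lemma integrable_lebesgue_on_iff:
  fixes g :: "'a::euclidean_space \<Rightarrow> 'b::euclidean_space"
  assumes "D \<in> sets lebesgue"
  shows "integrable (lebesgue_on D) g \<longleftrightarrow> integrable lebesgue (\<lambda>x. if x \<in> D then g x else 0)"
proof -
  have "(\<lambda>x. indicator D x *\<^sub>R g x) = (\<lambda>x. if x \<in> D then g x else 0)" by (auto simp: indicator_def)
  then show ?thesis using assms integrable_restrict_space[of D lebesgue g] by simp
qed

lemma integral_zero_extension:
  fixes g :: "'a::euclidean_space \<Rightarrow> 'b::euclidean_space"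
  assumes "D \<subseteq> E" "D \<in> sets lebesgue" "E \<in> sets lebesgue"
  shows "(LINT x|lebesgue_on E. (if x \<in> D then g x else 0)) = (LINT x|lebesgue_on D. g x)"
  using Lebesgue_Measure.integral_restrict_Int[OF assms(2,3), of g] assms(1) by (simp add: inf.absorb1)

lemma square_integrable_zero_extension:
  fixes g :: "plane \<Rightarrow> 'b::euclidean_space"
  assumes "D \<subseteq> E" "D \<in> sets lebesgue" "E \<in> sets lebesgue" "square_integrable D g"
  shows "square_integrable E (\<lambda>x. if x \<in> D then g x else 0)"
proof -
  have "(\<lambda>x. if x \<in> D then g x else 0) \<in> borel_measurable lebesgue"
    using assms borel_measurable_if square_integrable_def by blast
  then have m: "(\<lambda>x. if x \<in> D then g x else 0) \<in> borel_measurable (lebesgue_on E)"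
    using measurable_restrict_space1 by blast
  have eq: "(\<lambda>x. if x \<in> E then (norm (if x \<in> D then g x else 0))\<^sup>2 else 0) = (\<lambda>x. if x \<in> D then (norm (g x))\<^sup>2 else 0)"
    using assms(1) by (intro ext) auto
  show ?thesis using assms m
    by (simp add: square_integrable_def integrable_lebesgue_on_iff eq)
qed

lemma square_integrable_subset:
  fixes g :: "plane \<Rightarrow> 'b::euclidean_space"
  assumes "D \<subseteq> E" "D \<in> sets lebesgue" "E \<in> sets lebesgue" "square_integrable E g"
  shows "square_integrable D g"
proof -
  have m: "g \<in> borel_measurable (lebesgue_on D)"
    using measurable_restrict_mono[OF _ assms(1)] assms(4) square_integrable_def by blast
  have "integrable lebesgue (\<lambda>x. indicator D x *\<^sub>R (if x \<in> E then (norm (g x))\<^sup>2 else 0))"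
    using assms by (intro integrable_mult_indicator) (auto simp: square_integrable_def integrable_lebesgue_on_iff)
  moreover have "(\<lambda>x. indicator D x *\<^sub>R (if x \<in> E then (norm (g x))\<^sup>2 else 0)) = (\<lambda>x. if x \<in> D then (norm (g x))\<^sup>2 else 0)"
    using assms(1) by (intro ext) (auto simp: indicator_def)
  ultimately show ?thesis using assms m by (simp add: square_integrable_def integrable_lebesgue_on_iff)
qed

lemma square_integrable_diff:
  assumes "square_integrable D f" "square_integrable D g"
  shows "square_integrable D (\<lambda>x. f x - g x)"
proof -
  have [measurable]: "f \<in> borel_measurable (lebesgue_on D)" "g \<in> borel_measurable (lebesgue_on D)"
    using assms by (auto simp: square_integrable_def)
  have b: "(norm (f x - g x))\<^sup>2 \<le> 2 * (norm (f x))\<^sup>2 + 2 * (norm (g x))\<^sup>2" for x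
  proof -
    have "(norm (f x - g x))\<^sup>2 \<le> (norm (f x) + norm (g x))\<^sup>2"
      by (intro power_mono norm_triangle_ineq4) auto
    then show ?thesis using sum_squares_bound[of "norm (f x)" "norm (g x)"] by (simp add: power2_sum)
  qed
  have I: "integrable (lebesgue_on D) (\<lambda>x. 2 * (norm (f x))\<^sup>2 + 2 * (norm (g x))\<^sup>2)"
    using assms by (auto simp: square_integrable_def)
  have "integrable (lebesgue_on D) (\<lambda>x. (norm (f x - g x))\<^sup>2)"
    by (rule Bochner_Integration.integrable_bound[OF I]) (use b in auto)
  then show ?thesis by (simp add: square_integrable_def)
qed

lemma square_integrable_const:
  assumes "D \<in> lmeasurable"
  shows "square_integrable D (\<lambda>_. c)"
  using finite_measure.integrable_const[OF finite_measure_lebesgue_on[OF assms]]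
  by (simp add: square_integrable_def)

lemma L2_norm_cong_AE:
  assumes "square_integrable D f" "square_integrable D g" "AE x in lebesgue_on D. f x = g x"
  shows "L2_norm_on D f = L2_norm_on D g"
proof -
  have [measurable]: "f \<in> borel_measurable (lebesgue_on D)" "g \<in> borel_measurable (lebesgue_on D)"
    using assms by (auto simp: square_integrable_def)
  have "(LINT x|lebesgue_on D. (norm (f x))\<^sup>2) = (LINT x|lebesgue_on D. (norm (g x))\<^sup>2)"
    by (rule integral_cong_AE) (use assms(3) in auto)
  then show ?thesis by (simp add: L2_norm_on_def)
qed

lemma L2_norm_on_le:
  assumes S: "S \<subseteq> D" "S \<in> lmeasurable" "D \<in> sets lebesgue" and g: "square_integrable D g"
    and b: "\<And>x. x \<in> S \<Longrightarrow> norm (g x) \<le> M" "\<And>x. x \<notin> S \<Longrightarrow> g x = 0" and M: "0 \<le> M"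
  shows "L2_norm_on D g \<le> M * sqrt (measure lebesgue S)"
proof -
  have Sm: "S \<in> sets lebesgue" using S(2) by (simp add: fmeasurableD)
  have "(LINT x|lebesgue_on D. (norm (g x))\<^sup>2) \<le> (LINT x|lebesgue_on D. (if x \<in> S then M\<^sup>2 else 0))"
  proof (rule integral_mono)
    show "integrable (lebesgue_on D) (\<lambda>x. (norm (g x))\<^sup>2)" using g by (simp add: square_integrable_def)
    have "square_integrable D (\<lambda>x. if x \<in> S then M else 0)"
      by (rule square_integrable_zero_extension[OF S(1) Sm S(3) square_integrable_const[OF S(2)]])
    moreover have "(\<lambda>x. (norm (if x \<in> S then M else 0))\<^sup>2) = (\<lambda>x. if x \<in> S then M\<^sup>2 else 0)" by (rule ext) simp
    ultimately show "integrable (lebesgue_on D) (\<lambda>x. (if x \<in> S then M\<^sup>2 else 0))"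
      by (simp add: square_integrable_def)
    show "(norm (g x))\<^sup>2 \<le> (if x \<in> S then M\<^sup>2 else 0)" for x
      using b[of x] by (auto intro: power_mono)
  qed
  also have "\<dots> = (LINT x|lebesgue_on S. M\<^sup>2)" by (rule integral_zero_extension[OF S(1) Sm S(3)])
  also have "\<dots> = M\<^sup>2 * measure lebesgue S"
    using Sm by (simp add: measure_restrict_space mult.commute)
  finally show ?thesis
    unfolding L2_norm_on_def using M by (metis real_sqrt_le_mono real_sqrt_mult real_sqrt_abs abs_of_nonneg)
qed

text \<open>The boundary of a convex set is a null set. Estimates on a mesh element are therefore carried out on its
  interior, where the Sobolev spaces live.\<close>

lemma L2_norm_on_interior:
  assumes T: "convex T" "T \<in> sets lebesgue" and g: "square_integrable (interior T) g"
  shows "L2_norm_on T g = L2_norm_on (interior T) g"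
proof -
  let ?D = "interior T"
  let ?gT = "\<lambda>x. if x \<in> T then (norm (g x))\<^sup>2 else 0" and ?gD = "\<lambda>x. if x \<in> ?D then (norm (g x))\<^sup>2 else 0"
  have "(\<lambda>x. (norm (g x))\<^sup>2) \<in> borel_measurable (lebesgue_on ?D)" using g by (auto simp: square_integrable_def)
  then have gD: "?gD \<in> borel_measurable lebesgue" by (subst borel_measurable_if) auto
  have "frontier T \<in> null_sets lebesgue" using negligible_convex_frontier[OF T(1)] by (simp add: negligible_iff_null_sets)
  then have "AE x in lebesgue. x \<notin> frontier T" by (rule AE_not_in)
  then have ae: "AE x in lebesgue. ?gD x = ?gT x"
    by (rule eventually_mono) (use closure_subset interior_subset in \<open>auto simp: frontier_def\<close>)
  have gT: "?gT \<in> borel_measurable lebesgue" by (rule borel_measurable_AE[OF gD ae])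
  have "integral\<^sup>L lebesgue ?gD = integral\<^sup>L lebesgue ?gT" by (rule integral_cong_AE[OF gD gT ae])
  then show ?thesis
    using Lebesgue_Measure.integral_restrict_UNIV[OF T(2), of "\<lambda>x. (norm (g x))\<^sup>2"]
      Lebesgue_Measure.integral_restrict_UNIV[of ?D "\<lambda>x. (norm (g x))\<^sup>2"]
    by (simp add: L2_norm_on_def)
qed

section \<open>Integration by parts for test functions\<close>

lemma integrable_compact_support:
  fixes g :: "'a::euclidean_space \<Rightarrow> 'b::euclidean_space"
  assumes "continuous_on UNIV g" "compact K" "\<And>x. x \<notin> K \<Longrightarrow> g x = 0"
  shows "integrable lborel g"
proof -
  have "integrable lborel (\<lambda>x. indicator K x *\<^sub>R g x)"
    by (rule borel_integrable_compact[OF assms(2)]) (use assms(1) continuous_on_subset in blast)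
  moreover have "(\<lambda>x. indicator K x *\<^sub>R g x) = g" using assms(3) by (auto simp: indicator_def)
  ultimately show ?thesis by simp
qed

text \<open>Difference quotients of \<open>h\<close> integrate to zero because Lebesgue measure is translation invariant; they
  converge boundedly to the partial derivative, with supports in a common ball.\<close>

lemma integral_gradient_eq_0:
  assumes diff: "\<And>x. h differentiable at x"
    and cont: "continuous_on UNIV (\<lambda>x. gradient h x $ i)"
    and K: "compact K" and out: "\<And>x. x \<notin> K \<Longrightarrow> h x = 0 \<and> gradient h x $ i = 0"
  shows "(LINT x|lborel. gradient h x $ i) = 0"
proof -
  define e :: plane where "e = axis i 1"
  \<comment> \<open>the difference quotients along \<open>e\<close> with step \<open>1 / Suc n\<close>\<close>
  define q where "q n x = (h (inverse (real (Suc n)) *\<^sub>R e + x) - h x) * real (Suc n)" for n x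
  have conth: "continuous_on UNIV h"
    using diff differentiable_imp_continuous_within by (auto simp: continuous_on_eq_continuous_at)
  have [measurable]: "h \<in> borel_measurable borel" by (rule borel_measurable_continuous_onI[OF conth])
  have [measurable]: "(\<lambda>x. gradient h x $ i) \<in> borel_measurable borel" by (rule borel_measurable_continuous_onI[OF cont])
  have inth: "integrable lborel h"
    using integrable_compact_support[OF conth K] out by blast
  have tr: "(LINT x|lborel. h (c + x)) = (LINT x|lborel. h x)" for c
    using integral_distr[of "(+) c" lborel borel h] by (simp add: lborel_distr_plus)
  have itr: "integrable lborel (\<lambda>x. h (c + x))" for c
    using integrable_distr_eq[of "(+) c" lborel borel h] inth by (simp add: lborel_distr_plus)
  have q0: "(LINT x|lborel. q n x) = 0" for n
    unfolding q_def using itr[of "inverse (real (Suc n)) *\<^sub>R e"] inth by (simp add: tr del: of_nat_Suc)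
  have dline: "((\<lambda>t. h (t *\<^sub>R e + x)) has_derivative (\<lambda>s. s * gradient h (t *\<^sub>R e + x) $ i)) (at t)" for t x
  proof -
    have "((\<lambda>t. t *\<^sub>R e + x) has_derivative (\<lambda>s. s *\<^sub>R e)) (at t)"
      by (auto intro!: derivative_eq_intros)
    from has_derivative_compose[OF this has_derivative_gradient[OF diff]]
    show ?thesis by (simp add: e_def inner_axis)
  qed
  have lim: "(\<lambda>n. q n x) \<longlonglongrightarrow> gradient h x $ i" for x
  proof -
    have "((\<lambda>t. h (t *\<^sub>R e + x)) has_real_derivative gradient h x $ i) (at 0)"
      using dline[of x 0] unfolding has_field_derivative_def
      by (rule has_derivative_eq_rhs) (simp add: fun_eq_iff mult.commute)
    then have "((\<lambda>t. (h (t *\<^sub>R e + x) - h x) / t) \<longlongrightarrow> gradient h x $ i) (at 0)"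
      by (simp add: has_field_derivative_iff)
    moreover have "filterlim (\<lambda>n. inverse (real (Suc n))) (at 0) sequentially"
      unfolding filterlim_at using LIMSEQ_inverse_real_of_nat by (auto simp del: of_nat_Suc)
    ultimately have "((\<lambda>n. (h (inverse (real (Suc n)) *\<^sub>R e + x) - h x) / inverse (real (Suc n))) \<longlonglongrightarrow> gradient h x $ i)"
      by (rule filterlim_compose)
    then show ?thesis by (simp only: q_def divide_inverse inverse_inverse_eq)
  qed
  obtain M where M: "\<And>x. norm (gradient h x $ i) \<le> M" "M \<ge> 0"
  proof -
    have "bounded ((\<lambda>x. gradient h x $ i) ` K)"
      using compact_continuous_image[OF continuous_on_subset[OF cont] K] compact_imp_bounded by blast
    then obtain B where B: "B > 0" "\<And>x. x \<in> K \<Longrightarrow> norm (gradient h x $ i) \<le> B"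
      by (auto simp: bounded_pos)
    show ?thesis
      by (rule that[of B]) (use B out in \<open>metis norm_zero less_imp_le\<close>, use B in simp)
  qed
  obtain R where R: "\<And>x. x \<in> K \<Longrightarrow> norm x \<le> R"
    using compact_imp_bounded[OF K] by (auto simp: bounded_iff)
  define w where "w x = M * indicator (cball 0 (R + 1)) x" for x :: plane
  \<comment> \<open>the steps are at most \<open>1\<close>, hence the ball of radius \<open>R + 1\<close>; inside, the mean value theorem applies\<close>
  have bound: "norm (q n x) \<le> w x" for n x
  proof (cases "norm x \<le> R + 1")
    case True
    define t where "t = inverse (real (Suc n))"
    have t: "t > 0" by (simp add: t_def)
    obtain \<xi> where "h (t *\<^sub>R e + x) - h (0 *\<^sub>R e + x) = (t - 0) * gradient h (\<xi> *\<^sub>R e + x) $ i"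
      using mvt_simple[OF t, of "\<lambda>t. h (t *\<^sub>R e + x)" "\<lambda>t s. s * gradient h (t *\<^sub>R e + x) $ i"]
        dline has_derivative_at_withinI by blast
    moreover have "q n x = (h (t *\<^sub>R e + x) - h x) / t" by (simp only: q_def t_def divide_inverse inverse_inverse_eq)
    ultimately have "q n x = gradient h (\<xi> *\<^sub>R e + x) $ i" using t by simp
    then show ?thesis using M True by (simp add: w_def)
  next
    case False
    have "norm (inverse (real (Suc n)) *\<^sub>R e) \<le> 1"
      by (simp add: e_def norm_axis_1 field_simps)
    then have "norm x \<le> norm (inverse (real (Suc n)) *\<^sub>R e + x) + 1"
      using norm_triangle_ineq4[of "inverse (real (Suc n)) *\<^sub>R e + x" "inverse (real (Suc n)) *\<^sub>R e"] by simp
    then have "inverse (real (Suc n)) *\<^sub>R e + x \<notin> K" "x \<notin> K" using False R by fastforce+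
    then show ?thesis using out M by (simp add: q_def w_def)
  qed
  have "(\<lambda>n. LINT x|lborel. q n x) \<longlonglongrightarrow> (LINT x|lborel. gradient h x $ i)"
  proof (rule integral_dominated_convergence)
    show "integrable lborel w"
      unfolding w_def by (intro integrable_mult_right integrable_real_indicator) (use emeasure_bounded_finite[OF bounded_cball] in auto)
  qed (use lim bound in \<open>auto simp: q_def\<close>)
  then show ?thesis unfolding q0 using LIMSEQ_unique[OF tendsto_const] by metis
qed

lemma test_function_differentiable:
  assumes "test_function D \<phi>"
  shows "\<phi> differentiable at x" "continuous_on UNIV \<phi>" "continuous_on UNIV (gradient \<phi>)"
proof -
  have "times_cont_differentiable (Suc 0) \<phi>" "times_cont_differentiable 0 \<phi>"
    using assms by (auto simp: test_function_def simp del: times_cont_differentiable.simps)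
  then show "\<phi> differentiable at x" "continuous_on UNIV \<phi>" "continuous_on UNIV (gradient \<phi>)"
    by (auto simp: differentiable_on_def intro: continuous_on_vec_lambda[of UNIV "\<lambda>i x. gradient \<phi> x $ i", simplified])
qed

lemma gradient_eq_0_outside:
  assumes "x \<notin> closure {x. \<phi> x \<noteq> 0}"
  shows "gradient \<phi> x = 0"
proof -
  have "((\<lambda>_. 0) has_derivative (\<lambda>_. 0)) (at x)" by simp
  then have "(\<phi> has_derivative (\<lambda>_. 0)) (at x)"
    by (rule has_derivative_transform_within_open[of _ _ _ _ "- closure {x. \<phi> x \<noteq> 0}"])
       (use assms closure_subset[of "{x. \<phi> x \<noteq> 0}"] in auto)
  from gradient_component[OF this] show ?thesis by (simp add: vec_eq_iff)
qed

lemma test_function_compact_support: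
  assumes "test_function D \<phi>"
  obtains K where "compact K" "K \<subseteq> D" "\<And>x. x \<notin> K \<Longrightarrow> \<phi> x = 0" "\<And>x. x \<notin> K \<Longrightarrow> gradient \<phi> x = 0"
proof
  show "compact (closure {x. \<phi> x \<noteq> 0})" "closure {x. \<phi> x \<noteq> 0} \<subseteq> D"
    using assms by (auto simp: test_function_def)
  show "\<phi> x = 0" if "x \<notin> closure {x. \<phi> x \<noteq> 0}" for x
    using that closure_subset[of "{x. \<phi> x \<noteq> 0}"] by auto
qed (rule gradient_eq_0_outside)

lemma square_integrable_compact_support:
  fixes g :: "plane \<Rightarrow> 'b::euclidean_space"
  assumes "continuous_on UNIV g" "compact K" "\<And>x. x \<notin> K \<Longrightarrow> g x = 0" "D \<in> sets lebesgue"
  shows "square_integrable D g"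
proof -
  have "integrable lborel (\<lambda>x. (norm (g x))\<^sup>2)"
    by (rule integrable_compact_support[OF _ assms(2)]) (use assms(1,3) in \<open>simp_all add: continuous_on_norm continuous_on_power\<close>)
  then have "integrable lebesgue (\<lambda>x. (norm (g x))\<^sup>2)"
    using integrable_completion[of "\<lambda>x. (norm (g x))\<^sup>2" lborel] by auto
  then have "integrable lebesgue (\<lambda>x. indicator D x *\<^sub>R (norm (g x))\<^sup>2)"
    using assms(4) by (intro integrable_mult_indicator) auto
  moreover have "g \<in> borel_measurable (lebesgue_on D)"
    using borel_measurable_continuous_onI[OF assms(1)]
    by (intro measurable_restrict_space1 measurable_completion) simp
  ultimately show ?thesis using assms(4)
    by (simp add: square_integrable_def integrable_restrict_space)
qed

lemma test_function_square_integrable: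
  assumes "test_function D \<phi>" "E \<in> sets lebesgue"
  shows "square_integrable E \<phi>" "square_integrable E (gradient \<phi>)"
proof -
  obtain K where K: "compact K" "\<And>x. x \<notin> K \<Longrightarrow> \<phi> x = 0" "\<And>x. x \<notin> K \<Longrightarrow> gradient \<phi> x = 0"
    using test_function_compact_support[OF assms(1)] by metis
  show "square_integrable E \<phi>" "square_integrable E (gradient \<phi>)"
    by (rule square_integrable_compact_support[OF _ K(1) _ assms(2)];
        use K test_function_differentiable[OF assms(1)] in simp)+
qed

text \<open>The gradient of the product of \<open>h\<close> and \<open>\<phi>\<close> integrates to zero.\<close>

lemma integral_gradient_test_function:
  assumes D: "open D" and \<phi>: "test_function D \<phi>" and h: "\<And>x. h differentiable at x" "continuous_on UNIV (gradient h)"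
  shows "(LINT x|lebesgue_on D. h x *\<^sub>R gradient \<phi> x) = - (LINT x|lebesgue_on D. \<phi> x *\<^sub>R gradient h x)"
proof -
  obtain K where K: "compact K" "K \<subseteq> D" "\<And>x. x \<notin> K \<Longrightarrow> \<phi> x = 0" "\<And>x. x \<notin> K \<Longrightarrow> gradient \<phi> x = 0"
    using test_function_compact_support[OF \<phi>] by metis
  have Dm: "D \<in> sets lebesgue" using D by auto
  have hc: "continuous_on UNIV h" using h(1) differentiable_imp_continuous_within
    by (auto simp: continuous_on_eq_continuous_at)
  have c1: "continuous_on UNIV (\<lambda>x. h x *\<^sub>R gradient \<phi> x)" and c2: "continuous_on UNIV (\<lambda>x. \<phi> x *\<^sub>R gradient h x)"
    using h hc test_function_differentiable[OF \<phi>] by (auto intro!: continuous_intros)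
  have i1: "integrable lborel (\<lambda>x. h x *\<^sub>R gradient \<phi> x)" and i2: "integrable lborel (\<lambda>x. \<phi> x *\<^sub>R gradient h x)"
    by (rule integrable_compact_support[OF c1 K(1)], use K in simp,
        rule integrable_compact_support[OF c2 K(1)], use K in simp)
  have der: "((\<lambda>x. h x * \<phi> x) has_derivative (\<lambda>v. h x * (gradient \<phi> x \<bullet> v) + (gradient h x \<bullet> v) * \<phi> x)) (at x)" for x
    using h test_function_differentiable[OF \<phi>] by (intro has_derivative_mult has_derivative_gradient)
  have gr: "gradient (\<lambda>x. h x * \<phi> x) x = h x *\<^sub>R gradient \<phi> x + \<phi> x *\<^sub>R gradient h x" for x
    using gradient_component[OF der] by (simp add: vec_eq_iff inner_axis)
  have "(LINT x|lborel. h x *\<^sub>R gradient \<phi> x + \<phi> x *\<^sub>R gradient h x) $ i = 0" for i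
  proof -
    have "(LINT x|lborel. h x *\<^sub>R gradient \<phi> x + \<phi> x *\<^sub>R gradient h x) $ i = (LINT x|lborel. gradient (\<lambda>x. h x * \<phi> x) x $ i)"
      unfolding gr using i1 i2 by (intro integral_bounded_linear[OF bounded_linear_vec_nth, symmetric]) auto
    also have "\<dots> = 0"
    proof (rule integral_gradient_eq_0[OF _ _ K(1)])
      show "(\<lambda>x. h x * \<phi> x) differentiable at x" for x using der differentiable_def by blast
      show "continuous_on UNIV (\<lambda>x. gradient (\<lambda>x. h x * \<phi> x) x $ i)"
        unfolding gr by (intro continuous_on_component continuous_on_add c1 c2)
      show "h x * \<phi> x = 0 \<and> gradient (\<lambda>x. h x * \<phi> x) x $ i = 0" if "x \<notin> K" for x
        using K that by (simp add: gr)
    qed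
    finally show ?thesis .
  qed
  then have "(LINT x|lborel. h x *\<^sub>R gradient \<phi> x + \<phi> x *\<^sub>R gradient h x) = 0" by (simp add: vec_eq_iff)
  then have s: "(LINT x|lborel. h x *\<^sub>R gradient \<phi> x) = - (LINT x|lborel. \<phi> x *\<^sub>R gradient h x)"
    using i1 i2 by (simp add: eq_neg_iff_add_eq_0)
  have "(LINT x|lebesgue_on D. g x) = (LINT x|lborel. g x)"
    if "continuous_on UNIV g" "\<And>x. x \<notin> K \<Longrightarrow> g x = 0" for g :: "plane \<Rightarrow> plane"
  proof -
    have "(\<lambda>x. if x \<in> D then g x else 0) = g" using that K(2) by (intro ext) auto
    then have "(LINT x|lebesgue_on D. g x) = integral\<^sup>L lebesgue g"
      using Lebesgue_Measure.integral_restrict_UNIV[OF Dm, of g] by simp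
    then show ?thesis using integral_completion[of g lborel] borel_measurable_continuous_onI[OF that(1)] by simp
  qed
  from this[OF c1] this[OF c2] s show ?thesis using K by simp
qed

lemma test_function_has_weak_gradient:
  assumes "open D" "test_function D \<xi>"
  shows "has_weak_gradient D \<xi> (gradient \<xi>)"
  unfolding has_weak_gradient_def
  using assms test_function_square_integrable[OF assms(2), of D] test_function_differentiable[OF assms(2)]
    integral_gradient_test_function[OF assms(1), of _ \<xi>] by auto

text \<open>This is why constant vectors can be subtracted from the gradient of the solution.\<close>

lemma integral_gradient_test_function_eq_0:
  assumes "open D" "test_function D \<xi>"
  shows "(LINT x|lebesgue_on D. gradient \<xi> x) = 0"
proof -
  have g: "gradient (\<lambda>_. 1::real) x = 0" for x :: plane
    using gradient_component[of "\<lambda>_. 1" "\<lambda>_. 0" x] by (simp add: vec_eq_iff)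
  have "(LINT x|lebesgue_on D. 1 *\<^sub>R gradient \<xi> x) = - (LINT x|lebesgue_on D. \<xi> x *\<^sub>R gradient (\<lambda>_. 1) x)"
    by (rule integral_gradient_test_function[OF assms]) (simp_all add: g)
  then show ?thesis by (simp add: g)
qed

section \<open>Uniqueness of weak gradients\<close>

text \<open>In the Henstock lemma the integrals over the cells vanish, and what remains says that the Riemann sums of
  \<open>norm (g x)\<close> tend to zero. This replaces Lebesgue's differentiation theorem.\<close>

lemma null_outside_boxes:
  fixes g :: "'m::euclidean_space \<Rightarrow> 'n::euclidean_space"
  assumes z: "\<And>c d. cbox c d \<subseteq> cbox a b \<Longrightarrow> (g has_integral 0) (cbox c d)"
  shows "negligible {x \<in> cbox a b. g x \<noteq> 0}"
proof -
  have "((\<lambda>x. norm (g x)) has_integral 0) (cbox a b)"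
    unfolding has_integral
  proof (intro allI impI)
    fix e :: real assume "e > 0"
    have "g integrable_on cbox a b" using z by blast
    from Henstock_lemma[OF this \<open>e > 0\<close>] obtain \<gamma> where \<gamma>: "gauge \<gamma>"
      and H: "\<And>p. \<lbrakk>p tagged_partial_division_of (cbox a b); \<gamma> fine p\<rbrakk> \<Longrightarrow>
             sum (\<lambda>(x,k). norm(measure lborel k *\<^sub>R g x - integral k g)) p < e" by blast
    have "norm ((\<Sum>(x, k)\<in>D. measure lborel k *\<^sub>R norm (g x)) - 0) < e"
      if D: "D tagged_division_of cbox a b" "\<gamma> fine D" for D
    proof -
      have "(\<Sum>(x, k)\<in>D. measure lborel k *\<^sub>R norm (g x)) = (\<Sum>(x,k)\<in>D. norm(measure lborel k *\<^sub>R g x - integral k g))"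
      proof (rule sum.cong[OF refl], clarify)
        fix x k assume xk: "(x, k) \<in> D"
        obtain c d where k: "k = cbox c d" using tagged_division_ofD(4)[OF D(1) xk] by blast
        have "integral k g = 0" using z tagged_division_ofD(3)[OF D(1) xk] k integral_unique by blast
        then show "measure lborel k *\<^sub>R norm (g x) = norm (measure lborel k *\<^sub>R g x - integral k g)" by simp
      qed
      moreover have "0 \<le> (\<Sum>(x, k)\<in>D. measure lborel k *\<^sub>R norm (g x))" by (auto intro!: sum_nonneg)
      ultimately show ?thesis
        using H[OF D(1)[unfolded tagged_division_of_def, THEN conjunct1]] D(2) by simp
    qed
    then show "\<exists>\<gamma>. gauge \<gamma> \<and> (\<forall>D. D tagged_division_of cbox a b \<and> \<gamma> fine D \<longrightarrow>
        norm ((\<Sum>(x, k)\<in>D. measure lborel k *\<^sub>R norm (g x)) - 0) < e)" using \<gamma> by blast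
  qed
  then have "((\<lambda>x. if x \<in> cbox a b then norm (g x) else 0) has_integral 0) UNIV"
    by (simp add: has_integral_restrict_UNIV)
  then have m: "(\<lambda>x. if x \<in> cbox a b then norm (g x) else 0) \<in> borel_measurable lebesgue"
    and "integral\<^sup>N lebesgue (\<lambda>x. if x \<in> cbox a b then norm (g x) else 0) = ennreal 0"
    by (subst (asm) has_integral_iff_nn_integral_lebesgue; simp)+
  then have "AE x in lebesgue. ennreal (if x \<in> cbox a b then norm (g x) else 0) = 0"
    using nn_integral_0_iff_AE[of "\<lambda>x. ennreal (if x \<in> cbox a b then norm (g x) else 0)" lebesgue]
      measurable_compose[OF m measurable_ennreal] by simp
  then have "AE x in lebesgue. \<not> (x \<in> cbox a b \<and> g x \<noteq> 0)"
    by (rule eventually_mono) (auto split: if_splits)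
  then show ?thesis
    by (simp add: completion.AE_iff_null_sets negligible_iff_null_sets)
qed

text \<open>Box bumps are dominated by, and converge to, indicators of boxes; hence the integral of \<open>g\<close> over every
  box with closure in \<open>D\<close> vanishes.\<close>

lemma fundamental_lemma:
  fixes g :: "plane \<Rightarrow> 'b::euclidean_space"
  assumes D: "open D" and g: "square_integrable D g"
    and z: "\<And>\<phi>. test_function D \<phi> \<Longrightarrow> (LINT x|lebesgue_on D. \<phi> x *\<^sub>R g x) = 0"
  shows "AE x in lebesgue_on D. g x = 0"
proof -
  have Dm: "D \<in> sets lebesgue" using D by auto
  have [measurable]: "g \<in> borel_measurable (lebesgue_on D)" using g by (simp add: square_integrable_def)
  have box: "(g has_integral 0) (cbox c d)" if cd: "cbox c d \<subseteq> D" for c d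
  proof -
    let ?i = "indicator (cbox c d) :: plane \<Rightarrow> real"
    have tf: "test_function D (box_bump (real (Suc n)) c d)" for n
      using test_function_box_bump[of "real (Suc n)" c d D 1] cd by simp
    have sq: "square_integrable D ?i"
    proof -
      have "square_integrable (cbox c d) (\<lambda>_. 1::real)" by (simp add: square_integrable_const)
      from square_integrable_zero_extension[OF cd _ Dm this]
      have *: "square_integrable D (\<lambda>x. if x \<in> cbox c d then 1::real else 0)" by simp
      have "(\<lambda>x. if x \<in> cbox c d then 1 else 0) = ?i" by (auto simp: indicator_def)
      with * show ?thesis by simp
    qed
    have lim: "(\<lambda>n. LINT x|lebesgue_on D. box_bump (real (Suc n)) c d x *\<^sub>R g x) \<longlonglongrightarrow>
        (LINT x|lebesgue_on D. indicator (box c d) x *\<^sub>R g x)"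
    proof (rule integral_dominated_convergence)
      show "integrable (lebesgue_on D) (\<lambda>x. norm (?i x) * norm (g x))"
        by (rule norm_mult_integrable[OF sq g])
      show "AE x in lebesgue_on D. (\<lambda>n. box_bump (real (Suc n)) c d x *\<^sub>R g x) \<longlonglongrightarrow> indicator (box c d) x *\<^sub>R g x"
        by (intro AE_I2 tendsto_scaleR box_bump_tendsto tendsto_const)
      show "AE x in lebesgue_on D. norm (box_bump (real (Suc n)) c d x *\<^sub>R g x) \<le> norm (?i x) * norm (g x)" for n
      proof (rule AE_I2)
        fix x
        have "\<bar>box_bump (real (Suc n)) c d x\<bar> \<le> ?i x"
          using box_bump_bounds[of "real (Suc n)" c d x] box_bump_zero_iff[of "real (Suc n)" c d x] box_subset_cbox[of c d]
          by (cases "x \<in> cbox c d") (auto simp del: of_nat_Suc)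
        then show "norm (box_bump (real (Suc n)) c d x *\<^sub>R g x) \<le> norm (?i x) * norm (g x)"
          by (auto intro!: mult_right_mono simp del: of_nat_Suc)
      qed
      show "(\<lambda>x. box_bump (real (Suc n)) c d x *\<^sub>R g x) \<in> borel_measurable (lebesgue_on D)" for n
        using test_function_square_integrable(1)[OF tf Dm, of n]
        by (intro borel_measurable_scaleR) (simp_all add: square_integrable_def)
      show "(\<lambda>x. indicator (box c d) x *\<^sub>R g x) \<in> borel_measurable (lebesgue_on D)"
      proof -
        have [measurable]: "(indicator (box c d) :: plane \<Rightarrow> real) \<in> borel_measurable (lebesgue_on D)"
          by (intro measurable_restrict_space1 borel_measurable_indicator) auto
        show ?thesis by measurable
      qed
    qed
    have bD: "box c d \<subseteq> D" using cd box_subset_cbox by blast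
    have "(LINT x|lebesgue_on D. indicator (box c d) x *\<^sub>R g x) = (LINT x|lebesgue_on D. (if x \<in> box c d then g x else 0))"
      by (rule Bochner_Integration.integral_cong) (auto simp: indicator_def)
    also have "\<dots> = (LINT x|lebesgue_on (box c d). g x)" by (rule integral_zero_extension[OF bD _ Dm]) simp
    finally have i0: "(LINT x|lebesgue_on (box c d). g x) = 0"
      using LIMSEQ_unique[OF lim] z[OF tf] by simp
    have "square_integrable (box c d) g" by (rule square_integrable_subset[OF bD _ Dm g]) simp
    moreover have "square_integrable (box c d) (\<lambda>_. 1::real)" by (simp add: square_integrable_const)
    ultimately have "integrable (lebesgue_on (box c d)) g" using scaleR_integrable[of "box c d" "\<lambda>_. 1" g] by simp
    from has_integral_integral_lebesgue_on[OF this] i0 show ?thesis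
      by (simp add: has_integral_open_interval)
  qed
  have "negligible {x \<in> D. g x \<noteq> 0}"
  proof (subst locally_negligible_alt, clarify)
    fix x assume x: "x \<in> D" "g x \<noteq> 0"
    obtain a b where ab: "cbox a b \<subseteq> D" "x \<in> box a b" using open_contains_cbox[OF D x(1)] by metis
    have "negligible {x \<in> cbox a b. g x \<noteq> 0}"
      by (rule null_outside_boxes) (use box ab in blast)
    moreover have "{x \<in> D. g x \<noteq> 0} \<inter> box a b \<subseteq> {x \<in> cbox a b. g x \<noteq> 0}" using box_subset_cbox by fastforce
    ultimately have "negligible ({x \<in> D. g x \<noteq> 0} \<inter> box a b)" using negligible_subset by blast
    then show "\<exists>U. openin (top_of_set {x \<in> D. g x \<noteq> 0}) U \<and> x \<in> U \<and> negligible U"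
      using x ab by (intro exI[of _ "{x \<in> D. g x \<noteq> 0} \<inter> box a b"]) (auto simp: openin_open_Int)
  qed
  then have "AE x in lebesgue. x \<in> D \<longrightarrow> g x = 0"
    by (simp add: completion.AE_iff_null_sets negligible_iff_null_sets conj_commute)
  then show ?thesis using Dm by (simp add: AE_restrict_space_iff)
qed

lemma has_weak_gradient_square_integrable:
  assumes "has_weak_gradient D v G"
  shows "square_integrable D v" "square_integrable D G"
  using assms by (auto simp: has_weak_gradient_def)

lemma has_weak_gradient_diff:
  assumes "open D" "has_weak_gradient D v G" "has_weak_gradient D w H"
  shows "has_weak_gradient D (\<lambda>x. v x - w x) (\<lambda>x. G x - H x)"
proof -
  note sq = has_weak_gradient_square_integrable[OF assms(2)] has_weak_gradient_square_integrable[OF assms(3)]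
  have "(LINT x|lebesgue_on D. (v x - w x) *\<^sub>R gradient \<phi> x) = - (LINT x|lebesgue_on D. \<phi> x *\<^sub>R (G x - H x))"
    if \<phi>: "test_function D \<phi>" for \<phi>
  proof -
    have t: "square_integrable D \<phi>" "square_integrable D (gradient \<phi>)"
      using test_function_square_integrable[OF \<phi>] assms(1) by auto
    have "(LINT x|lebesgue_on D. v x *\<^sub>R gradient \<phi> x) = - (LINT x|lebesgue_on D. \<phi> x *\<^sub>R G x)"
      "(LINT x|lebesgue_on D. w x *\<^sub>R gradient \<phi> x) = - (LINT x|lebesgue_on D. \<phi> x *\<^sub>R H x)"
      using assms(2,3) \<phi> by (auto simp: has_weak_gradient_def)
    then show ?thesis
      using scaleR_integrable[OF sq(1) t(2)] scaleR_integrable[OF sq(3) t(2)]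
        scaleR_integrable[OF t(1) sq(2)] scaleR_integrable[OF t(1) sq(4)]
      by (simp add: scaleR_diff_left scaleR_diff_right)
  qed
  then show ?thesis using sq by (simp add: has_weak_gradient_def square_integrable_diff)
qed

lemma weak_gradient_unique:
  assumes D: "open D" and "has_weak_gradient D v G" "has_weak_gradient D v H"
  shows "AE x in lebesgue_on D. G x = H x"
proof -
  have w: "has_weak_gradient D (\<lambda>x. v x - v x) (\<lambda>x. G x - H x)"
    by (rule has_weak_gradient_diff[OF assms])
  have "AE x in lebesgue_on D. G x - H x = 0"
  proof (rule fundamental_lemma[OF D has_weak_gradient_square_integrable(2)[OF w]])
    show "(LINT x|lebesgue_on D. \<phi> x *\<^sub>R (G x - H x)) = 0" if "test_function D \<phi>" for \<phi>
    proof -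
      have "(LINT x|lebesgue_on D. (v x - v x) *\<^sub>R gradient \<phi> x) = - (LINT x|lebesgue_on D. \<phi> x *\<^sub>R (G x - H x))"
        using w that unfolding has_weak_gradient_def by blast
      then show ?thesis by simp
    qed
  qed
  then show ?thesis by simp
qed

lemma has_weak_gradient_weak_gradient:
  assumes "v \<in> H1 D"
  shows "has_weak_gradient D v (weak_gradient D v)"
  using someI_ex[of "has_weak_gradient D v"] assms by (simp add: H1_def weak_gradient_def)

lemma weak_gradient_eq_AE:
  assumes "open D" "has_weak_gradient D v G"
  shows "AE x in lebesgue_on D. weak_gradient D v x = G x"
proof -
  have "v \<in> H1 D" using assms by (auto simp: H1_def)
  then show ?thesis
    using weak_gradient_unique[OF assms(1) has_weak_gradient_weak_gradient assms(2)] by blast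
qed

text \<open>The norm may be computed with any weak gradient, since they agree almost everywhere.\<close>

lemma H1_norm_eq:
  assumes "open D" "has_weak_gradient D v G"
  shows "H1_norm D v = sqrt ((L2_norm_on D v)\<^sup>2 + (L2_norm_on D G)\<^sup>2)"
proof -
  have "v \<in> H1 D" using assms by (auto simp: H1_def)
  from has_weak_gradient_weak_gradient[OF this]
  have "L2_norm_on D (weak_gradient D v) = L2_norm_on D G"
    using weak_gradient_eq_AE[OF assms] assms(2)
    by (intro L2_norm_cong_AE) (auto simp: has_weak_gradient_def)
  then show ?thesis by (simp add: H1_norm_def)
qed

lemma L2_norms_le_H1_norm:
  assumes "open D" "has_weak_gradient D v G"
  shows "L2_norm_on D v \<le> H1_norm D v" "L2_norm_on D G \<le> H1_norm D v"
  unfolding H1_norm_eq[OF assms] by (rule real_le_rsqrt; simp)+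

lemma H1_norm_nonneg: "0 \<le> H1_norm D v"
  by (simp add: H1_norm_def)

section \<open>Zero extension\<close>

text \<open>The constant sequence approximates. That the norm of the zero difference vanishes is not immediate,
  because the selected weak gradient of the zero function is only almost everywhere zero.\<close>

lemma test_function_in_H10:
  assumes "open D" "test_function D \<xi>"
  shows "\<xi> \<in> H10 D"
proof -
  note w = test_function_has_weak_gradient[OF assms]
  have "H1_norm D (\<lambda>x. \<xi> x - \<xi> x) = 0"
    using H1_norm_eq[OF assms(1) has_weak_gradient_diff[OF assms(1) w w]] by (simp add: L2_norm_on_def)
  moreover have "\<xi> \<in> H1 D" using w by (auto simp: H1_def)
  ultimately show ?thesis
    unfolding H10_def using assms(2) by (auto intro!: exI[of _ "\<lambda>_. \<xi>"])
qed

text \<open>The test function \<open>\<eta>\<close> need not vanish on the boundary of \<open>D\<close>: the identity holds for the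
  approximating test functions on \<open>D\<close>, whose own supports are compact in \<open>D\<close>, and both sides are continuous
  in the \<open>H1\<close> norm.\<close>

lemma H10_integration_by_parts:
  assumes D: "open D" and \<xi>: "\<xi> \<in> H10 D" and \<eta>: "test_function E \<eta>"
  shows "(LINT x|lebesgue_on D. \<xi> x *\<^sub>R gradient \<eta> x) = - (LINT x|lebesgue_on D. \<eta> x *\<^sub>R weak_gradient D \<xi> x)"
proof -
  let ?G = "weak_gradient D \<xi>"
  have Dm: "D \<in> sets lebesgue" using D by auto
  obtain \<phi> where \<phi>: "\<And>n::nat. test_function D (\<phi> n)" and lim: "(\<lambda>n. H1_norm D (\<lambda>x. \<xi> x - \<phi> n x)) \<longlonglongrightarrow> 0"
    and "\<xi> \<in> H1 D" using \<xi> by (auto simp: H10_def)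
  note w = has_weak_gradient_weak_gradient[OF \<open>\<xi> \<in> H1 D\<close>]
  note sq = has_weak_gradient_square_integrable[OF w]
  note sc = test_function_square_integrable[OF \<eta> Dm]
  let ?S = "(LINT x|lebesgue_on D. \<xi> x *\<^sub>R gradient \<eta> x) + (LINT x|lebesgue_on D. \<eta> x *\<^sub>R ?G x)"
  let ?C = "L2_norm_on D (gradient \<eta>) + L2_norm_on D \<eta>"
  \<comment> \<open>\<open>?S\<close> is unchanged when \<open>\<phi> n\<close> is subtracted from \<open>\<xi>\<close>\<close>
  have b: "norm ?S \<le> H1_norm D (\<lambda>x. \<xi> x - \<phi> n x) * ?C" for n
  proof -
    note wd = has_weak_gradient_diff[OF D w test_function_has_weak_gradient[OF D \<phi>[of n]]]
    note sd = has_weak_gradient_square_integrable[OF wd]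
    note sp = test_function_square_integrable[OF \<phi>[of n] Dm]
    have "(LINT x|lebesgue_on D. \<eta> x *\<^sub>R gradient (\<phi> n) x) = - (LINT x|lebesgue_on D. \<phi> n x *\<^sub>R gradient \<eta> x)"
      by (rule integral_gradient_test_function[OF D \<phi> test_function_differentiable(1,3)[OF \<eta>]])
    then have "?S = (LINT x|lebesgue_on D. (\<xi> x - \<phi> n x) *\<^sub>R gradient \<eta> x)
        + (LINT x|lebesgue_on D. \<eta> x *\<^sub>R (?G x - gradient (\<phi> n) x))"
      using scaleR_integrable[OF sq(1) sc(2)] scaleR_integrable[OF sp(1) sc(2)]
        scaleR_integrable[OF sc(1) sq(2)] scaleR_integrable[OF sc(1) sp(2)]
      by (simp add: scaleR_diff_left scaleR_diff_right)
    then have "norm ?S \<le> L2_norm_on D (\<lambda>x. \<xi> x - \<phi> n x) * L2_norm_on D (gradient \<eta>)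
        + L2_norm_on D \<eta> * L2_norm_on D (\<lambda>x. ?G x - gradient (\<phi> n) x)"
      using norm_triangle_mono[OF norm_integral_scaleR_le[OF sd(1) sc(2)] norm_integral_scaleR_le[OF sc(1) sd(2)]]
      by simp
    also have "\<dots> \<le> H1_norm D (\<lambda>x. \<xi> x - \<phi> n x) * L2_norm_on D (gradient \<eta>)
        + L2_norm_on D \<eta> * H1_norm D (\<lambda>x. \<xi> x - \<phi> n x)"
      by (intro add_mono mult_right_mono mult_left_mono L2_norms_le_H1_norm[OF D wd] L2_norm_on_nonneg)
    finally show ?thesis by (simp add: algebra_simps)
  qed
  have "(\<lambda>n. H1_norm D (\<lambda>x. \<xi> x - \<phi> n x) * ?C) \<longlonglongrightarrow> 0 * ?C"
    by (intro tendsto_mult lim tendsto_const)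
  from tendsto_lowerbound[OF this, of "norm ?S"] b have "norm ?S \<le> 0" by simp
  then show ?thesis by (simp add: eq_neg_iff_add_eq_0)
qed

lemma H10_zero_extension:
  assumes D: "open D" and E: "open E" and DE: "D \<subseteq> E" and \<xi>: "\<xi> \<in> H10 D"
  shows "has_weak_gradient E (\<lambda>x. if x \<in> D then \<xi> x else 0) (\<lambda>x. if x \<in> D then weak_gradient D \<xi> x else 0)"
proof -
  have m: "D \<in> sets lebesgue" "E \<in> sets lebesgue" using D E by auto
  have "\<xi> \<in> H1 D" using \<xi> by (simp add: H10_def)
  note sq = has_weak_gradient_square_integrable[OF has_weak_gradient_weak_gradient[OF this]]
  have "(LINT x|lebesgue_on E. (if x \<in> D then \<xi> x else 0) *\<^sub>R gradient \<eta> x)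
      = - (LINT x|lebesgue_on E. \<eta> x *\<^sub>R (if x \<in> D then weak_gradient D \<xi> x else 0))"
    if \<eta>: "test_function E \<eta>" for \<eta>
  proof -
    have "(LINT x|lebesgue_on E. (if x \<in> D then \<xi> x else 0) *\<^sub>R gradient \<eta> x)
        = (LINT x|lebesgue_on E. (if x \<in> D then \<xi> x *\<^sub>R gradient \<eta> x else 0))"
      by (rule Bochner_Integration.integral_cong) auto
    also have "\<dots> = (LINT x|lebesgue_on D. \<xi> x *\<^sub>R gradient \<eta> x)"
      by (rule integral_zero_extension[OF DE m])
    also have "\<dots> = - (LINT x|lebesgue_on D. \<eta> x *\<^sub>R weak_gradient D \<xi> x)"
      by (rule H10_integration_by_parts[OF D \<xi> \<eta>])
    also have "(LINT x|lebesgue_on D. \<eta> x *\<^sub>R weak_gradient D \<xi> x)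
        = (LINT x|lebesgue_on E. (if x \<in> D then \<eta> x *\<^sub>R weak_gradient D \<xi> x else 0))"
      by (rule integral_zero_extension[OF DE m, symmetric])
    also have "\<dots> = (LINT x|lebesgue_on E. \<eta> x *\<^sub>R (if x \<in> D then weak_gradient D \<xi> x else 0))"
      by (rule Bochner_Integration.integral_cong) auto
    finally show ?thesis .
  qed
  then show ?thesis
    unfolding has_weak_gradient_def
    using square_integrable_zero_extension[OF DE m sq(1)] square_integrable_zero_extension[OF DE m sq(2)] by blast
qed

section \<open>The multiplier error on a mesh element\<close>

lemma interior_mesh_element:
  assumes "convex_polygonal_domain \<Omega>" "mesh_of \<Omega> \<T>" "T \<in> \<T>"
  shows "interior T \<subseteq> \<Omega>"
proof -
  have "T \<subseteq> closure \<Omega>" using assms(2,3) by (auto simp: mesh_of_def)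
  then have "interior T \<subseteq> interior (closure \<Omega>)" by (rule interior_mono)
  also have "\<dots> = \<Omega>"
    using assms(1) by (simp add: convex_polygonal_domain_def convex_interior_closure interior_open)
  finally show ?thesis .
qed

lemma mesh_element_polytope:
  assumes "mesh_of \<Omega> \<T>" "T \<in> \<T>"
  shows "polytope T" "T \<in> sets lebesgue" "interior T \<in> lmeasurable"
proof -
  show p: "polytope T" using assms simplex_imp_polytope unfolding mesh_of_def by blast
  show "T \<in> sets lebesgue" using polytope_imp_compact[OF p] by (simp add: fmeasurableD lmeasurable_compact)
  show "interior T \<in> lmeasurable" using polytope_imp_bounded[OF p] by (simp add: lmeasurable_interior)
qed

text \<open>In a conforming mesh the intersection of two elements is a face of both. A face that meets the interior
  is improper: hence \<open>T\<close> is itself a face of \<open>T'\<close>, and it meets the interior of \<open>T'\<close> in turn.\<close>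

lemma mesh_element_meets_interior:
  assumes "mesh_of \<Omega> \<T>" "T \<in> \<T>" "T' \<in> \<T>" "x \<in> T'" "x \<in> interior T"
  shows "T' = T"
proof -
  have faces: "(T \<inter> T') face_of T" "(T' \<inter> T) face_of T'"
    using assms by (auto simp: mesh_of_def triangulation_def)
  have "x \<in> T \<inter> T'" using assms interior_subset by blast
  then have "T \<inter> T' = T" using face_of_disjoint_interior[OF faces(1)] assms(5) by blast
  then have TT: "T \<subseteq> T'" and Tf: "T face_of T'" using faces by (auto simp: inf.commute)
  have "x \<in> interior T'" using interior_mono[OF TT] assms(5) by blast
  then show ?thesis using face_of_disjoint_interior[OF Tf] assms(5) interior_subset by blast
qed

text \<open>Extending by zero turns all integrals into integrals over the interior of \<open>T\<close>. For the bilinear form this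
  is the rule for weak gradients of zero extensions; for the discrete multiplier it uses that the other
  elements do not meet the interior of \<open>T\<close>.\<close>

lemma multiplier_error_eq:
  assumes \<Omega>: "convex_polygonal_domain \<Omega>" and mesh: "mesh_of \<Omega> \<T>" and T: "T \<in> \<T>"
    and f: "square_integrable \<Omega> f" and u: "u \<in> H1 \<Omega>" and \<mu>: "\<And>x. x \<in> T \<Longrightarrow> \<mu> T x = c"
    and \<xi>: "\<xi> \<in> H10 (interior T)"
  shows "multiplier \<Omega> f u (\<lambda>x. if x \<in> interior T then \<xi> x else 0)
      - broken_functional \<T> \<mu> (\<lambda>x. if x \<in> interior T then \<xi> x else 0)
    = (LINT x|lebesgue_on (interior T). (f x - c) * \<xi> x)
      - (LINT x|lebesgue_on (interior T). weak_gradient \<Omega> u x \<bullet> weak_gradient (interior T) \<xi> x)"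
proof -
  let ?D = "interior T" and ?Gu = "weak_gradient \<Omega> u" and ?G = "weak_gradient (interior T) \<xi>"
  let ?\<xi> = "\<lambda>x. if x \<in> interior T then \<xi> x else 0" and ?GE = "\<lambda>x. if x \<in> interior T then weak_gradient (interior T) \<xi> x else 0"
  have O: "open \<Omega>" using \<Omega> by (simp add: convex_polygonal_domain_def)
  have fin: "finite \<T>" using mesh by (simp add: mesh_of_def triangulation_def)
  note sub = interior_mesh_element[OF \<Omega> mesh T]
  have m: "?D \<in> sets lebesgue" "\<Omega> \<in> sets lebesgue" using O by auto
  note Dl = mesh_element_polytope(3)[OF mesh T]
  have \<xi>1: "\<xi> \<in> H1 ?D" using \<xi> by (simp add: H10_def)
  note sq = has_weak_gradient_square_integrable[OF has_weak_gradient_weak_gradient[OF \<xi>1]]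
  note wE = H10_zero_extension[OF open_interior O sub \<xi>]
  have \<xi>E: "?\<xi> \<in> H1 \<Omega>" using wE by (auto simp: H1_def)
  have load: "load \<Omega> f ?\<xi> = (LINT x|lebesgue_on ?D. f x * \<xi> x)"
  proof -
    have "load \<Omega> f ?\<xi> = (LINT x|lebesgue_on \<Omega>. (if x \<in> ?D then f x * \<xi> x else 0))"
      unfolding load_def by (rule Bochner_Integration.integral_cong) auto
    then show ?thesis using integral_zero_extension[OF sub m, of "\<lambda>x. f x * \<xi> x"] by simp
  qed
  have aform: "a_form \<Omega> u ?\<xi> = (LINT x|lebesgue_on ?D. ?Gu x \<bullet> ?G x)"
  proof -
    have [measurable]: "?Gu \<in> borel_measurable (lebesgue_on \<Omega>)" "weak_gradient \<Omega> ?\<xi> \<in> borel_measurable (lebesgue_on \<Omega>)"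
      "?GE \<in> borel_measurable (lebesgue_on \<Omega>)"
      using has_weak_gradient_weak_gradient[OF u] has_weak_gradient_weak_gradient[OF \<xi>E] wE
      by (auto simp: has_weak_gradient_def square_integrable_def)
    have "a_form \<Omega> u ?\<xi> = (LINT x|lebesgue_on \<Omega>. ?Gu x \<bullet> ?GE x)"
      unfolding a_form_def
    proof (rule integral_cong_AE)
      show "AE x in lebesgue_on \<Omega>. ?Gu x \<bullet> weak_gradient \<Omega> ?\<xi> x = ?Gu x \<bullet> ?GE x"
        using weak_gradient_eq_AE[OF O wE] by (rule eventually_mono) simp
    qed measurable
    also have "\<dots> = (LINT x|lebesgue_on \<Omega>. (if x \<in> ?D then ?Gu x \<bullet> ?G x else 0))"
      by (rule Bochner_Integration.integral_cong) auto
    finally show ?thesis using integral_zero_extension[OF sub m, of "\<lambda>x. ?Gu x \<bullet> ?G x"] by simp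
  qed
  have broken: "broken_functional \<T> \<mu> ?\<xi> = (LINT x|lebesgue_on ?D. c * \<xi> x)"
  proof -
    have z: "(LINT x|lebesgue_on T'. \<mu> T' x * ?\<xi> x) = 0" if "T' \<in> \<T> - {T}" for T'
    proof -
      have "(LINT x|lebesgue_on T'. \<mu> T' x * ?\<xi> x) = (LINT x|lebesgue_on T'. 0)"
        by (rule Bochner_Integration.integral_cong)
           (use that mesh_element_meets_interior[OF mesh T, of T'] in auto)
      then show ?thesis by simp
    qed
    note Tm = mesh_element_polytope(2)[OF mesh T]
    have "broken_functional \<T> \<mu> ?\<xi> = (LINT x|lebesgue_on T. \<mu> T x * ?\<xi> x)"
      unfolding broken_functional_def by (subst sum.remove[OF fin T]) (use z in \<open>simp add: sum.neutral\<close>)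
    also have "\<dots> = (LINT x|lebesgue_on T. (if x \<in> ?D then c * \<xi> x else 0))"
      by (rule Bochner_Integration.integral_cong) (auto simp: \<mu>)
    finally show ?thesis using integral_zero_extension[OF interior_subset m(1) Tm, of "\<lambda>x. c * \<xi> x"] by simp
  qed
  have i1: "integrable (lebesgue_on ?D) (\<lambda>x. f x * \<xi> x)"
    using inner_integrable[OF square_integrable_subset[OF sub m f] sq(1)] by simp
  have i2: "integrable (lebesgue_on ?D) (\<lambda>x. c * \<xi> x)"
    using inner_integrable[OF square_integrable_const[OF Dl] sq(1), of c] by simp
  show ?thesis
    unfolding multiplier_def load aform broken
    using i1 i2 by (simp add: left_diff_distrib)
qed

text \<open>The supremum is a real one, so the functional has to be shown to be bounded first. The same bound covers
  functions of zero norm, which the supremum leaves out.\<close>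

lemma multiplier_error_le_dual_norm:
  assumes \<Omega>: "convex_polygonal_domain \<Omega>" and mesh: "mesh_of \<Omega> \<T>" and T: "T \<in> \<T>"
    and f: "square_integrable \<Omega> f" and u: "u \<in> H1 \<Omega>" and \<mu>: "\<And>x. x \<in> T \<Longrightarrow> \<mu> T x = c"
    and \<xi>: "\<xi> \<in> H10 (interior T)"
  shows "multiplier \<Omega> f u (\<lambda>x. if x \<in> interior T then \<xi> x else 0)
      - broken_functional \<T> \<mu> (\<lambda>x. if x \<in> interior T then \<xi> x else 0)
    \<le> H_minus1_norm (interior T) (\<lambda>v. multiplier \<Omega> f u v - broken_functional \<T> \<mu> v) * H1_norm (interior T) \<xi>"
proof -
  let ?D = "interior T"
  define g where "g = (\<lambda>v. multiplier \<Omega> f u v - broken_functional \<T> \<mu> v)"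
  define ext where "ext \<zeta> = (\<lambda>x. if x \<in> ?D then \<zeta> x else 0)" for \<zeta> :: "plane \<Rightarrow> real"
  define C where "C = L2_norm_on ?D (\<lambda>x. f x - c) + L2_norm_on ?D (weak_gradient \<Omega> u)"
  have O: "open \<Omega>" using \<Omega> by (simp add: convex_polygonal_domain_def)
  note sub = interior_mesh_element[OF \<Omega> mesh T]
  have m: "?D \<in> sets lebesgue" "\<Omega> \<in> sets lebesgue" using O by auto
  note Dl = mesh_element_polytope(3)[OF mesh T]
  have sf: "square_integrable ?D (\<lambda>x. f x - c)"
    by (intro square_integrable_diff square_integrable_subset[OF sub m f] square_integrable_const Dl)
  have su: "square_integrable ?D (weak_gradient \<Omega> u)"
    using has_weak_gradient_weak_gradient[OF u]
    by (intro square_integrable_subset[OF sub m]) (simp add: has_weak_gradient_def)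
  have bound: "\<bar>g (ext \<zeta>)\<bar> \<le> C * H1_norm ?D \<zeta>" if "\<zeta> \<in> H10 ?D" for \<zeta>
  proof -
    have "\<zeta> \<in> H1 ?D" using that by (simp add: H10_def)
    note w = has_weak_gradient_weak_gradient[OF this]
    note sq = has_weak_gradient_square_integrable[OF w]
    have "g (ext \<zeta>) = (LINT x|lebesgue_on ?D. (f x - c) * \<zeta> x)
      - (LINT x|lebesgue_on ?D. weak_gradient \<Omega> u x \<bullet> weak_gradient ?D \<zeta> x)"
      unfolding g_def ext_def by (rule multiplier_error_eq[OF \<Omega> mesh T f u _ that]) (rule \<mu>)
    then have "\<bar>g (ext \<zeta>)\<bar> \<le> L2_norm_on ?D (\<lambda>x. f x - c) * L2_norm_on ?D \<zeta>
        + L2_norm_on ?D (weak_gradient \<Omega> u) * L2_norm_on ?D (weak_gradient ?D \<zeta>)"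
      using Cauchy_Schwarz_inner[OF sf sq(1)] Cauchy_Schwarz_inner[OF su sq(2)] by simp
    also have "\<dots> \<le> L2_norm_on ?D (\<lambda>x. f x - c) * H1_norm ?D \<zeta> + L2_norm_on ?D (weak_gradient \<Omega> u) * H1_norm ?D \<zeta>"
      by (intro add_mono mult_left_mono L2_norms_le_H1_norm[OF open_interior w] L2_norm_on_nonneg)
    finally show ?thesis by (simp add: C_def algebra_simps)
  qed
  have "g (ext \<xi>) \<le> H_minus1_norm ?D g * H1_norm ?D \<xi>"
  proof (cases "H1_norm ?D \<xi> = 0")
    case True
    then show ?thesis using bound[OF \<xi>] by simp
  next
    case False
    then have pos: "H1_norm ?D \<xi> > 0" using H1_norm_nonneg[of ?D \<xi>] by linarith
    let ?A = "{g (\<lambda>x. if x \<in> ?D then \<zeta> x else 0) / H1_norm ?D \<zeta> | \<zeta>. \<zeta> \<in> H10 ?D \<and> H1_norm ?D \<zeta> \<noteq> 0}"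
    have "bdd_above ?A"
    proof (rule bdd_aboveI[of _ C], clarify)
      fix \<zeta> assume z: "\<zeta> \<in> H10 ?D" "H1_norm ?D \<zeta> \<noteq> 0"
      then have "H1_norm ?D \<zeta> > 0" using H1_norm_nonneg[of ?D \<zeta>] by linarith
      then show "g (\<lambda>x. if x \<in> ?D then \<zeta> x else 0) / H1_norm ?D \<zeta> \<le> C"
        using bound[OF z(1)] by (simp add: ext_def divide_le_eq)
    qed
    then have "g (ext \<xi>) / H1_norm ?D \<xi> \<le> Sup ?A"
      using \<xi> False by (intro cSup_upper) (auto simp: ext_def)
    then show ?thesis using pos by (simp add: H_minus1_norm_def divide_le_eq)
  qed
  then show ?thesis by (simp add: g_def ext_def)
qed

section \<open>The element bubble\<close>

text \<open>The product of functions bounded by one is again bounded by one, and the gradient bounds add up; thus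
  the rule can be iterated over the four factors of a bump.\<close>

lemma norm_gradient_mult_le:
  assumes "g differentiable at x" "h differentiable at x" "\<bar>g x\<bar> \<le> 1" "\<bar>h x\<bar> \<le> 1"
    "norm (gradient g x) \<le> A" "norm (gradient h x) \<le> B"
  shows "(\<lambda>x. g x * h x) differentiable at x" "\<bar>g x * h x\<bar> \<le> 1" "norm (gradient (\<lambda>x. g x * h x) x) \<le> A + B"
proof -
  have d: "((\<lambda>x. g x * h x) has_derivative (\<lambda>v. g x * (gradient h x \<bullet> v) + (gradient g x \<bullet> v) * h x)) (at x)"
    using assms by (intro has_derivative_mult has_derivative_gradient)
  then show "(\<lambda>x. g x * h x) differentiable at x" using differentiable_def by blast
  show "\<bar>g x * h x\<bar> \<le> 1" using assms by (simp add: abs_mult mult_le_one)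
  have "gradient (\<lambda>x. g x * h x) x = h x *\<^sub>R gradient g x + g x *\<^sub>R gradient h x"
    using gradient_component[OF d] by (simp add: vec_eq_iff inner_axis)
  then have "norm (gradient (\<lambda>x. g x * h x) x) \<le> \<bar>h x\<bar> * norm (gradient g x) + \<bar>g x\<bar> * norm (gradient h x)"
    using norm_triangle_ineq[of "h x *\<^sub>R gradient g x" "g x *\<^sub>R gradient h x"] by simp
  also have "\<dots> \<le> 1 * A + 1 * B"
    using assms by (intro add_mono mult_mono) auto
  finally show "norm (gradient (\<lambda>x. g x * h x) x) \<le> A + B" by simp
qed

lemma norm_gradient_flat_exp_le:
  fixes i :: 2
  shows "(\<lambda>x::plane. flat_exp 0 (\<alpha> * x $ i + \<beta>)) differentiable at x"
    "\<bar>flat_exp 0 (\<alpha> * x $ i + \<beta>)\<bar> \<le> 1"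
    "norm (gradient (\<lambda>x. flat_exp 0 (\<alpha> * x $ i + \<beta>)) x) \<le> 2 * \<bar>\<alpha>\<bar>"
proof -
  note d = flat_affine_has_derivative[of 0 \<alpha> i \<beta> x, simplified]
  show "(\<lambda>x::plane. flat_exp 0 (\<alpha> * x $ i + \<beta>)) differentiable at x" using d differentiable_def by blast
  show "\<bar>flat_exp 0 (\<alpha> * x $ i + \<beta>)\<bar> \<le> 1" by (simp add: flat_exp_nonneg flat_exp_0_le_1)
  have "gradient (\<lambda>x. flat_exp 0 (\<alpha> * x $ i + \<beta>)) x = (flat_exp 2 (\<alpha> * x $ i + \<beta>) * \<alpha>) *\<^sub>R axis i 1"
    using gradient_component[OF d] by (auto simp: vec_eq_iff axis_def numeral_2_eq_2)
  then have "norm (gradient (\<lambda>x. flat_exp 0 (\<alpha> * x $ i + \<beta>)) x) = flat_exp 2 (\<alpha> * x $ i + \<beta>) * \<bar>\<alpha>\<bar>"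
    by (simp add: norm_axis_1 abs_mult flat_exp_nonneg)
  then show "norm (gradient (\<lambda>x. flat_exp 0 (\<alpha> * x $ i + \<beta>)) x) \<le> 2 * \<bar>\<alpha>\<bar>"
    using flat_exp_2_le_2 by (simp add: mult_right_mono)
qed

lemma norm_gradient_box_bump_le: "norm (gradient (box_bump s a b) x) \<le> 8 * \<bar>s\<bar>"
proof -
  have eq: "box_bump s a b = (\<lambda>x. (flat_exp 0 (s * x $ 1 + (- (s * a $ 1))) * flat_exp 0 ((- s) * x $ 1 + s * b $ 1))
      * (flat_exp 0 (s * x $ 2 + (- (s * a $ 2))) * flat_exp 0 ((- s) * x $ 2 + s * b $ 2)))"
    by (rule ext) (simp add: box_bump_def UNIV_2 algebra_simps)
  note m = norm_gradient_mult_le[OF norm_gradient_flat_exp_le(1)[of s _ _ x] norm_gradient_flat_exp_le(1)[of "-s" _ _ x]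
      norm_gradient_flat_exp_le(2)[of s x] norm_gradient_flat_exp_le(2)[of "-s" x]
      norm_gradient_flat_exp_le(3)[of s _ _ x] norm_gradient_flat_exp_le(3)[of "-s" _ _ x]]
  show ?thesis
    unfolding eq
    using norm_gradient_mult_le(3)[OF m(1)[of 1 "- (s * a $ 1)" 1 "s * b $ 1"] m(1)[of 2 "- (s * a $ 2)" 2 "s * b $ 2"] m(2) m(2) m(3) m(3)]
    by simp
qed

definition cube :: "plane \<Rightarrow> real \<Rightarrow> plane set" where
  "cube c \<rho> = cbox (\<chi> i. c $ i - \<rho>) (\<chi> i. c $ i + \<rho>)"

lemma mem_cube: "x \<in> cube c \<rho> \<longleftrightarrow> (\<forall>i. \<bar>(x - c) $ i\<bar> \<le> \<rho>)"
proof -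
  have "c $ i - \<rho> \<le> x $ i \<and> x $ i \<le> c $ i + \<rho> \<longleftrightarrow> \<bar>(x - c) $ i\<bar> \<le> \<rho>" for i
    unfolding vector_minus_component by linarith
  then show ?thesis by (simp add: cube_def mem_box_cart)
qed

lemma measure_cube: "0 \<le> \<rho> \<Longrightarrow> measure lebesgue (cube c \<rho>) = 4 * \<rho>\<^sup>2"
proof -
  assume r: "0 \<le> \<rho>"
  then have "c \<in> cube c \<rho>" by (simp add: cube_def mem_box_cart)
  then have "cube c \<rho> \<noteq> {}" by blast
  then show ?thesis unfolding cube_def
    by (subst measure_completion; simp add: content_cbox_cart UNIV_2 power2_eq_square)
qed

definition bubble :: "plane \<Rightarrow> real \<Rightarrow> plane \<Rightarrow> real" where
  "bubble c \<rho> = box_bump (1 / \<rho>) (\<chi> i. c $ i - \<rho>) (\<chi> i. c $ i + \<rho>)"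

lemma bubble_eq_0:
  assumes "\<rho> > 0" "x \<notin> cube c \<rho>"
  shows "bubble c \<rho> x = 0"
proof -
  let ?a = "\<chi> i. c $ i - \<rho>" and ?b = "\<chi> i. c $ i + \<rho>"
  have "x \<notin> box ?a ?b" using assms(2) box_subset_cbox[of ?a ?b] by (auto simp: cube_def)
  then show ?thesis using box_bump_zero_iff[of "1 / \<rho>" ?a ?b x] assms(1) by (simp add: bubble_def)
qed

lemma test_function_bubble:
  assumes "\<rho> > 0" "cube c \<rho> \<subseteq> D"
  shows "test_function D (\<lambda>x. k * bubble c \<rho> x)"
  unfolding bubble_def
  by (rule test_function_box_bump) (use assms in \<open>simp_all add: cube_def\<close>)

lemma L2_norm_bubble_le:
  fixes k :: real
  assumes \<rho>: "\<rho> > 0" and D: "open D" "cube c \<rho> \<subseteq> D"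
  defines "\<xi> \<equiv> (\<lambda>x. k * bubble c \<rho> x)"
  shows "L2_norm_on D \<xi> \<le> \<bar>k\<bar> * (2 * \<rho>)"
    and "L2_norm_on D (gradient \<xi>) \<le> \<bar>k\<bar> * 16"
proof -
  let ?a = "\<chi> i. c $ i - \<rho>" and ?b = "\<chi> i. c $ i + \<rho>"
  have Dm: "D \<in> sets lebesgue" using D by auto
  have cl: "cube c \<rho> \<in> lmeasurable" by (simp add: cube_def)
  have sqr: "sqrt (measure lebesgue (cube c \<rho>)) = 2 * \<rho>"
    using \<rho> by (simp add: measure_cube real_sqrt_mult)
  note t = test_function_bubble[OF \<rho> D(2), of k, folded \<xi>_def]
  note sq = test_function_square_integrable[OF t Dm]
  note z = bubble_eq_0[OF \<rho>]
  have "L2_norm_on D \<xi> \<le> \<bar>k\<bar> * sqrt (measure lebesgue (cube c \<rho>))"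
    by (rule L2_norm_on_le[OF D(2) cl Dm sq(1)])
       (use z box_bump_bounds in \<open>auto simp: \<xi>_def abs_mult bubble_def intro!: mult_left_le\<close>)
  then show "L2_norm_on D \<xi> \<le> \<bar>k\<bar> * (2 * \<rho>)" by (simp add: sqr)
  have diff: "bubble c \<rho> differentiable at x" for x
    unfolding bubble_def using bump_expr_gradient[OF bump_expr_box_bump] by blast
  have gr: "gradient \<xi> x = k *\<^sub>R gradient (bubble c \<rho>) x" for x
  proof -
    have "(\<xi> has_derivative (\<lambda>v. k * (gradient (bubble c \<rho>) x \<bullet> v))) (at x)"
      unfolding \<xi>_def by (intro has_derivative_mult_right has_derivative_gradient diff)
    from gradient_component[OF this] show ?thesis by (simp add: vec_eq_iff inner_axis)
  qed
  have "L2_norm_on D (gradient \<xi>) \<le> (\<bar>k\<bar> * (8 / \<rho>)) * sqrt (measure lebesgue (cube c \<rho>))"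
  proof (rule L2_norm_on_le[OF D(2) cl Dm sq(2)])
    show "norm (gradient \<xi> x) \<le> \<bar>k\<bar> * (8 / \<rho>)" for x
      using mult_left_mono[OF norm_gradient_box_bump_le[of "1 / \<rho>" ?a ?b x], of "\<bar>k\<bar>"] \<rho>
      by (simp add: gr bubble_def)
    show "gradient \<xi> x = 0" if "x \<notin> cube c \<rho>" for x
    proof (rule gradient_eq_0_outside)
      have "closure {x. \<xi> x \<noteq> 0} \<subseteq> cube c \<rho>"
        by (rule closure_minimal) (use z in \<open>auto simp: \<xi>_def cube_def\<close>)
      then show "x \<notin> closure {x. \<xi> x \<noteq> 0}" using that by blast
    qed
  qed (use \<rho> in auto)
  then show "L2_norm_on D (gradient \<xi>) \<le> \<bar>k\<bar> * 16" using \<rho> by (simp add: sqr)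
qed

lemma integral_bubble_ge:
  assumes \<rho>: "\<rho> > 0" and D: "open D" "cube c \<rho> \<subseteq> D"
  shows "exp (- 8) * \<rho>\<^sup>2 \<le> (LINT x|lebesgue_on D. bubble c \<rho> x)"
proof -
  let ?a = "\<chi> i. c $ i - \<rho>" and ?b = "\<chi> i. c $ i + \<rho>"
  have Dm: "D \<in> sets lebesgue" using D by auto
  have cl: "cube c \<rho> \<in> lmeasurable" by (simp add: cube_def)
  note z = bubble_eq_0[OF \<rho>]
  have half: "cube c (\<rho> / 2) \<subseteq> D"
  proof -
    have "cube c (\<rho> / 2) \<subseteq> cube c \<rho>"
      unfolding cube_def by (rule subset_box_imp) (use \<rho> in \<open>auto simp: Basis_vec_def inner_axis\<close>)
    then show ?thesis using D(2) by blast
  qed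
  \<comment> \<open>on the half cube all four arguments are at least \<open>1 / 2\<close>, so each factor is at least \<open>exp (- 2)\<close>\<close>
  have lower: "exp (- 8) \<le> bubble c \<rho> x" if "x \<in> cube c (\<rho> / 2)" for x
  proof -
    have e: "exp (- 2) \<le> flat_exp 0 t" if "t \<ge> 1 / 2" for t
    proof -
      have "1 / t \<le> 2" using that by (simp add: divide_le_eq)
      then show ?thesis using that by (simp add: flat_exp_def)
    qed
    have f: "exp (- 4) \<le> flat_exp 0 (1 / \<rho> * (x $ i - ?a $ i)) * flat_exp 0 (1 / \<rho> * (?b $ i - x $ i))" for i
    proof -
      have "c $ i - \<rho> / 2 \<le> x $ i" "x $ i \<le> c $ i + \<rho> / 2" using that by (simp_all add: cube_def mem_box_cart)
      then have "1 / 2 \<le> 1 / \<rho> * (x $ i - ?a $ i)" "1 / 2 \<le> 1 / \<rho> * (?b $ i - x $ i)"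
        using \<rho> by (simp_all add: field_simps)
      from e[OF this(1)] e[OF this(2)]
      have "exp (- 2) * exp (- 2) \<le> flat_exp 0 (1 / \<rho> * (x $ i - ?a $ i)) * flat_exp 0 (1 / \<rho> * (?b $ i - x $ i))"
        by (intro mult_mono) (auto simp: flat_exp_nonneg)
      then show ?thesis by (simp add: exp_add[symmetric])
    qed
    have "exp (- 4) * exp (- 4) \<le> bubble c \<rho> x"
      unfolding bubble_def box_bump_def UNIV_2 using mult_mono[OF f[of 1] f[of 2]]
      by (simp add: flat_exp_nonneg)
    then show ?thesis by (simp add: exp_add[symmetric])
  qed
  have hm: "cube c (\<rho> / 2) \<in> lmeasurable" "cube c (\<rho> / 2) \<in> sets lebesgue" by (simp_all add: cube_def)
  have "exp (- 8) * \<rho>\<^sup>2 = (LINT x|lebesgue_on (cube c (\<rho> / 2)). exp (- 8))"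
    using hm \<rho> by (simp add: measure_restrict_space measure_cube power_divide)
  also have "\<dots> = (LINT x|lebesgue_on D. (if x \<in> cube c (\<rho> / 2) then exp (- 8) else 0))"
    by (rule integral_zero_extension[OF half hm(2) Dm, symmetric])
  also have "\<dots> \<le> (LINT x|lebesgue_on D. bubble c \<rho> x)"
  proof (rule integral_mono)
    have "integrable (lebesgue_on (cube c (\<rho> / 2))) (\<lambda>_. exp (- 8) :: real)"
      using finite_measure.integrable_const[OF finite_measure_lebesgue_on[OF hm(1)]] .
    then have "integrable lebesgue (\<lambda>x. if x \<in> cube c (\<rho> / 2) then exp (- 8) else 0 :: real)"
      using hm by (simp add: integrable_lebesgue_on_iff)
    moreover have "(\<lambda>x. if x \<in> D then if x \<in> cube c (\<rho> / 2) then exp (- 8) else 0 else 0)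
        = (\<lambda>x. if x \<in> cube c (\<rho> / 2) then exp (- 8) else 0 :: real)"
      by (rule ext) (use half in auto)
    ultimately show "integrable (lebesgue_on D) (\<lambda>x. if x \<in> cube c (\<rho> / 2) then exp (- 8) else 0 :: real)"
      using Dm by (simp add: integrable_lebesgue_on_iff)
    have sqb: "square_integrable (cube c \<rho>) (bubble c \<rho>)"
      using test_function_square_integrable(1)[OF test_function_bubble[OF \<rho> D(2), of 1]] cl by (simp add: fmeasurableD)
    have "integrable (lebesgue_on (cube c \<rho>)) (bubble c \<rho>)"
      using scaleR_integrable[OF square_integrable_const[OF cl, of 1] sqb] by simp
    then have "integrable lebesgue (\<lambda>x. if x \<in> cube c \<rho> then bubble c \<rho> x else 0)"
      using cl by (simp add: integrable_lebesgue_on_iff fmeasurableD)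
    moreover have "(\<lambda>x. if x \<in> cube c \<rho> then bubble c \<rho> x else 0) = (\<lambda>x. if x \<in> D then bubble c \<rho> x else 0)"
      by (rule ext) (use D(2) z in auto)
    ultimately show "integrable (lebesgue_on D) (bubble c \<rho>)"
      using Dm by (simp add: integrable_lebesgue_on_iff)
    show "(if x \<in> cube c (\<rho> / 2) then exp (- 8) else 0) \<le> bubble c \<rho> x" for x
      using lower box_bump_bounds(1) by (simp add: bubble_def)
  qed
  finally show "exp (- 8) * \<rho>\<^sup>2 \<le> (LINT x|lebesgue_on D. bubble c \<rho> x)" .
qed

text \<open>Some inscribed ball has a radius \<open>r\<close> exceeding half the inradius. A concentric cube of half side \<open>r / 4\<close> lies
  in the closed ball of radius \<open>r / 2\<close>, safely inside the open ball.\<close>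

lemma shape_regular_cube:
  assumes "diameter T \<le> \<sigma> * inradius T" "\<sigma> > 0" "diameter T > 0" "bounded T"
  obtains c \<rho> where "\<rho> > 0" "cube c \<rho> \<subseteq> interior T" "diameter T \<le> 8 * \<sigma> * \<rho>" "\<rho> \<le> diameter T"
proof -
  let ?A = "{r. \<exists>x. cball x r \<subseteq> T}"
  have pos: "inradius T > 0"
    using mult_nonneg_nonpos[of \<sigma> "inradius T"] assms(1-3) by linarith
  have lt: "inradius T / 2 < Sup ?A" using pos unfolding inradius_def by linarith
  \<comment> \<open>a ball of negative radius is empty\<close>
  have "-1 \<in> ?A" by (intro CollectI exI[of _ 0]) simp
  then have ne: "?A \<noteq> {}" by (rule ex_in_conv[THEN iffD1, OF exI])
  obtain r where rA: "r \<in> ?A" and r: "inradius T / 2 < r" by (rule less_cSupE[OF lt ne])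
  obtain c where c: "cball c r \<subseteq> T" using rA by (rule CollectE) (erule exE)
  have r0: "r > 0" using r pos by linarith
  show ?thesis
  proof (rule that[of "r / 4" c])
    have "cube c (r / 4) \<subseteq> ball c r"
    proof
      fix x assume "x \<in> cube c (r / 4)"
      then have "\<bar>(x - c) $ i\<bar> \<le> r / 4" for i by (simp only: mem_cube)
      then have "norm (x - c) \<le> r / 2"
        using norm_le_l1_cart[of "x - c"] sum_mono[of UNIV "\<lambda>i. \<bar>(x - c) $ i\<bar>" "\<lambda>_::2. r / 4"] by simp
      then show "x \<in> ball c r" using r0 by (simp add: dist_norm norm_minus_commute)
    qed
    also have "\<dots> \<subseteq> interior T" using c ball_subset_cball by (intro interior_maximal) auto
    finally show "cube c (r / 4) \<subseteq> interior T" .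
    have "\<sigma> * inradius T \<le> \<sigma> * (2 * r)" using r assms(2) by (intro mult_left_mono) auto
    then show "diameter T \<le> 8 * \<sigma> * (r / 4)" using assms(1) by simp
    show "r / 4 \<le> diameter T" using diameter_subset[OF c assms(4)] r0 by simp
  qed (use r0 in simp)
qed

section \<open>Local efficiency\<close>

text \<open>The multiplier error is tested with \<open>k\<close> times the bubble, where \<open>k = b - c\<close>. The sign of \<open>k\<close> in the test
  function turns the left side into \<open>k\<^sup>2\<close> times the integral of the bubble, and one factor \<open>\<bar>k\<bar>\<close> cancels.\<close>

lemma constant_residual_bound:
  assumes \<Omega>: "convex_polygonal_domain \<Omega>" and mesh: "mesh_of \<Omega> \<T>" and T: "T \<in> \<T>"
    and f: "square_integrable \<Omega> f" and u: "u \<in> H1 \<Omega>" and \<mu>: "\<And>x. x \<in> T \<Longrightarrow> \<mu> T x = c"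
    and \<rho>: "\<rho> > 0" "cube x0 \<rho> \<subseteq> interior T"
  defines "D \<equiv> interior T"
  defines "S \<equiv> \<bar>H_minus1_norm D (\<lambda>v. multiplier \<Omega> f u v - broken_functional \<T> \<mu> v)\<bar>"
  shows "\<bar>b - c\<bar> * (exp (- 8) * \<rho>\<^sup>2) \<le>
    (2 * \<rho> + 16) * (S + L2_norm_on D (\<lambda>x. weak_gradient \<Omega> u x - g)) + 2 * \<rho> * L2_norm_on D (\<lambda>x. f x - b)"
proof -
  define k where "k = b - c"
  define \<xi> where "\<xi> = (\<lambda>x. k * bubble x0 \<rho> x)"
  define N where "N = L2_norm_on D (\<lambda>x. weak_gradient \<Omega> u x - g)"
  define P where "P = L2_norm_on D (\<lambda>x. f x - b)"
  let ?G = "weak_gradient D \<xi>"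
  have D: "open D" by (simp add: D_def)
  have O: "open \<Omega>" using \<Omega> by (simp add: convex_polygonal_domain_def)
  note sub = interior_mesh_element[OF \<Omega> mesh T, folded D_def]
  have m: "D \<in> sets lebesgue" "\<Omega> \<in> sets lebesgue" using O D by auto
  note Dl = mesh_element_polytope(3)[OF mesh T, folded D_def]
  note tf = test_function_bubble[OF \<rho>(1) \<rho>(2)[folded D_def], of k, folded \<xi>_def]
  note bb = L2_norm_bubble_le[OF \<rho>(1) D \<rho>(2)[folded D_def], of k, folded \<xi>_def]
  note w = test_function_has_weak_gradient[OF D tf]
  note s\<xi> = has_weak_gradient_square_integrable[OF w]
  have sf: "square_integrable D (\<lambda>x. f x - b)"
    by (intro square_integrable_diff square_integrable_subset[OF sub m f] square_integrable_const Dl)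
  have su: "square_integrable D (weak_gradient \<Omega> u)"
    using has_weak_gradient_weak_gradient[OF u]
    by (intro square_integrable_subset[OF sub m]) (simp add: has_weak_gradient_def)
  have sg: "square_integrable D (\<lambda>_. g)" by (rule square_integrable_const[OF Dl])
  have sug: "square_integrable D (\<lambda>x. weak_gradient \<Omega> u x - g)" by (rule square_integrable_diff[OF su sg])
  have \<xi>H: "\<xi> \<in> H10 D" by (rule test_function_in_H10[OF D tf])
  have grad0: "(LINT x|lebesgue_on D. g \<bullet> gradient \<xi> x) = 0"
  proof -
    have "integrable (lebesgue_on D) (gradient \<xi>)"
      using scaleR_integrable[OF square_integrable_const[OF Dl] s\<xi>(2), of 1] by simp
    then have "(LINT x|lebesgue_on D. g \<bullet> gradient \<xi> x) = g \<bullet> (LINT x|lebesgue_on D. gradient \<xi> x)"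
      by (intro integral_inner_right) simp
    then show ?thesis using integral_gradient_test_function_eq_0[OF D tf] by simp
  qed
  have ugrad: "(LINT x|lebesgue_on D. weak_gradient \<Omega> u x \<bullet> ?G x)
      = (LINT x|lebesgue_on D. (weak_gradient \<Omega> u x - g) \<bullet> gradient \<xi> x)"
  proof -
    have [measurable]: "weak_gradient \<Omega> u \<in> borel_measurable (lebesgue_on D)" "gradient \<xi> \<in> borel_measurable (lebesgue_on D)"
      using su s\<xi> by (auto simp: square_integrable_def)
    have "\<xi> \<in> H1 D" using w by (auto simp: H1_def)
    then have [measurable]: "?G \<in> borel_measurable (lebesgue_on D)"
      using has_weak_gradient_weak_gradient by (auto simp: has_weak_gradient_def square_integrable_def)
    have "(LINT x|lebesgue_on D. weak_gradient \<Omega> u x \<bullet> ?G x) = (LINT x|lebesgue_on D. weak_gradient \<Omega> u x \<bullet> gradient \<xi> x)"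
    proof (rule integral_cong_AE)
      show "AE x in lebesgue_on D. weak_gradient \<Omega> u x \<bullet> ?G x = weak_gradient \<Omega> u x \<bullet> gradient \<xi> x"
        using weak_gradient_eq_AE[OF D w] by (rule eventually_mono) simp
    qed measurable
    then show ?thesis
      using inner_integrable[OF su s\<xi>(2)] inner_integrable[OF sg s\<xi>(2)] grad0 by (simp add: inner_diff_left)
  qed
  have fsplit: "(LINT x|lebesgue_on D. (f x - c) * \<xi> x)
      = (LINT x|lebesgue_on D. (f x - b) * \<xi> x) + k * (LINT x|lebesgue_on D. \<xi> x)"
  proof -
    have i: "integrable (lebesgue_on D) (\<lambda>x. (f x - b) * \<xi> x)" "integrable (lebesgue_on D) (\<lambda>x. k * \<xi> x)"
      using inner_integrable[OF sf s\<xi>(1)] inner_integrable[OF square_integrable_const[OF Dl] s\<xi>(1), of k] by simp_all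
    have "(\<lambda>x. (f x - c) * \<xi> x) = (\<lambda>x. (f x - b) * \<xi> x + k * \<xi> x)" by (rule ext) (simp add: k_def algebra_simps)
    then show ?thesis using i by simp
  qed
  have H1: "H1_norm D \<xi> \<le> \<bar>k\<bar> * (2 * \<rho> + 16)"
  proof -
    have "H1_norm D \<xi> \<le> L2_norm_on D \<xi> + L2_norm_on D (gradient \<xi>)"
      unfolding H1_norm_eq[OF D w] by (rule sqrt_sum_squares_le_sum) (auto simp: L2_norm_on_nonneg)
    also have "\<dots> \<le> \<bar>k\<bar> * (2 * \<rho> + 16)" using bb by (simp add: algebra_simps)
    finally show ?thesis .
  qed
  have "k * (LINT x|lebesgue_on D. \<xi> x) \<le> S * (\<bar>k\<bar> * (2 * \<rho> + 16)) + P * (\<bar>k\<bar> * (2 * \<rho>)) + N * (\<bar>k\<bar> * 16)"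
  proof -
    let ?g = "\<lambda>v. multiplier \<Omega> f u v - broken_functional \<T> \<mu> v"
    have e: "?g (\<lambda>x. if x \<in> D then \<xi> x else 0) = (LINT x|lebesgue_on D. (f x - c) * \<xi> x)
        - (LINT x|lebesgue_on D. weak_gradient \<Omega> u x \<bullet> ?G x)"
      unfolding D_def by (rule multiplier_error_eq[OF \<Omega> mesh T f u _ \<xi>H[unfolded D_def]]) (rule \<mu>)
    have "?g (\<lambda>x. if x \<in> D then \<xi> x else 0) \<le> H_minus1_norm D ?g * H1_norm D \<xi>"
      unfolding D_def by (rule multiplier_error_le_dual_norm[OF \<Omega> mesh T f u _ \<xi>H[unfolded D_def]]) (rule \<mu>)
    also have "\<dots> \<le> S * H1_norm D \<xi>"
      unfolding S_def by (intro mult_right_mono abs_ge_self H1_norm_nonneg)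
    also have "\<dots> \<le> S * (\<bar>k\<bar> * (2 * \<rho> + 16))"
      by (intro mult_left_mono H1) (simp add: S_def)
    finally have A: "?g (\<lambda>x. if x \<in> D then \<xi> x else 0) \<le> S * (\<bar>k\<bar> * (2 * \<rho> + 16))" .
    have B: "\<bar>LINT x|lebesgue_on D. (f x - b) * \<xi> x\<bar> \<le> P * (\<bar>k\<bar> * (2 * \<rho>))"
      using Cauchy_Schwarz_inner[OF sf s\<xi>(1)] mult_left_mono[OF bb(1) L2_norm_on_nonneg[of D "\<lambda>x. f x - b"]]
      by (simp add: P_def)
    have C: "\<bar>LINT x|lebesgue_on D. (weak_gradient \<Omega> u x - g) \<bullet> gradient \<xi> x\<bar> \<le> N * (\<bar>k\<bar> * 16)"
      using Cauchy_Schwarz_inner[OF sug s\<xi>(2)] mult_left_mono[OF bb(2) L2_norm_on_nonneg[of D "\<lambda>x. weak_gradient \<Omega> u x - g"]]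
      by (simp add: N_def)
    show ?thesis using e[unfolded ugrad fsplit] A B C by linarith
  qed
  moreover have "k * (LINT x|lebesgue_on D. \<xi> x) \<ge> k\<^sup>2 * (exp (- 8) * \<rho>\<^sup>2)"
    using mult_left_mono[OF integral_bubble_ge[OF \<rho>(1) D \<rho>(2)[folded D_def]], of "k\<^sup>2"] by (simp add: \<xi>_def power2_eq_square)
  moreover have "\<bar>k\<bar> * (\<bar>k\<bar> * (exp (- 8) * \<rho>\<^sup>2)) = k\<^sup>2 * (exp (- 8) * \<rho>\<^sup>2)"
    by (simp add: power2_eq_square flip: mult.assoc)
  moreover have "S * (\<bar>k\<bar> * (2 * \<rho> + 16)) + P * (\<bar>k\<bar> * (2 * \<rho>)) + N * (\<bar>k\<bar> * 16)
      = \<bar>k\<bar> * (S * (2 * \<rho> + 16) + P * (2 * \<rho>) + N * 16)"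
    by (simp add: algebra_simps)
  ultimately have k2: "\<bar>k\<bar> * (\<bar>k\<bar> * (exp (- 8) * \<rho>\<^sup>2)) \<le> \<bar>k\<bar> * (S * (2 * \<rho> + 16) + P * (2 * \<rho>) + N * 16)"
    by linarith
  have nn: "0 \<le> S" "0 \<le> P" "0 \<le> N" by (simp_all add: S_def P_def N_def L2_norm_on_nonneg)
  have "\<bar>k\<bar> * (exp (- 8) * \<rho>\<^sup>2) \<le> S * (2 * \<rho> + 16) + P * (2 * \<rho>) + N * 16"
  proof (cases "k = 0")
    case True
    then show ?thesis using nn \<rho>(1) by simp
  next
    case False
    then show ?thesis
      using k2 by (simp only: mult_le_cancel_left_pos[of "\<bar>k\<bar>"] zero_less_abs_iff not_False_eq_True)
  qed
  also have "\<dots> \<le> (2 * \<rho> + 16) * (S + N) + 2 * \<rho> * P"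
    using mult_nonneg_nonneg[of N \<rho>] nn \<rho>(1) by (simp add: algebra_simps)
  finally show ?thesis by (simp add: k_def N_def P_def)
qed

lemma measure_le_diameter_square:
  fixes T :: "plane set"
  assumes "bounded T" "x \<in> T"
  shows "measure lebesgue (interior T) \<le> 4 * (diameter T)\<^sup>2"
proof -
  have "T \<subseteq> cube x (diameter T)"
  proof
    fix y assume "y \<in> T"
    then have "\<bar>(y - x) $ i\<bar> \<le> diameter T" for i
      using diameter_bounded_bound[OF assms(1) \<open>y \<in> T\<close> assms(2)] component_le_norm_cart[of "y - x" i]
      by (simp add: dist_norm)
    then show "y \<in> cube x (diameter T)" unfolding mem_cube by blast
  qed
  then have "measure lebesgue (interior T) \<le> measure lebesgue (cube x (diameter T))"
    using interior_subset[of T] assms(1)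
    by (intro measure_mono_fmeasurable) (auto simp: cube_def)
  then show ?thesis using measure_cube diameter_ge_0[OF assms(1)] by simp
qed

text \<open>The residual is split into \<open>f - b\<close>, which is the oscillation, and the number \<open>b - c\<close>, which the bubble controls.

  The constant arises from the factor \<open>2\<close> for the square of this sum, from the area bound \<open>4 * h\<^sup>2\<close>, from \<open>h ^ 4 \<le> 4096 * \<sigma> ^ 4 * \<rho> ^ 4\<close>, and from the factor \<open>3\<close>
  for the square of a sum of three terms: \<open>2 * 4 * 4096 * 3 = 98304\<close>.\<close>

lemma efficiency_on_element:
  assumes \<Omega>: "convex_polygonal_domain \<Omega>" and mesh: "mesh_of \<Omega> \<T>" and T: "T \<in> \<T>"
    and f: "square_integrable \<Omega> f" and u: "u \<in> H1 \<Omega>"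
    and \<mu>: "\<mu> \<in> W_h \<T>" and fbar: "fbar \<in> W_h \<T>"
    and reg: "diameter T \<le> \<sigma> * inradius T" and \<sigma>: "\<sigma> > 0"
  shows "(diameter T)\<^sup>2 * (L2_norm_on T (\<lambda>x. f x - \<mu> T x))\<^sup>2
    \<le> (2 + 98304 * \<sigma> ^ 4 * (exp 8 * (2 * diameter \<Omega> + 16))\<^sup>2) *
       ((L2_norm_on T (\<lambda>x. weak_gradient \<Omega> u x - g))\<^sup>2 + (oscillation f fbar T)\<^sup>2
        + (H_minus1_norm (interior T) (\<lambda>v. multiplier \<Omega> f u v - broken_functional \<T> \<mu> v))\<^sup>2)"
proof -
  define D where "D = interior T"
  define h where "h = diameter T"
  define d where "d = diameter \<Omega>"
  define K where "K = 2 * d + 16"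
  obtain c where c: "\<And>x. x \<in> T \<Longrightarrow> \<mu> T x = c" using \<mu> T by (auto simp: W_h_def)
  obtain b where b: "\<And>x. x \<in> T \<Longrightarrow> fbar T x = b" using fbar T by (auto simp: W_h_def)
  define k where "k = b - c"
  define S where "S = \<bar>H_minus1_norm D (\<lambda>v. multiplier \<Omega> f u v - broken_functional \<T> \<mu> v)\<bar>"
  define N where "N = L2_norm_on D (\<lambda>x. weak_gradient \<Omega> u x - g)"
  define P where "P = L2_norm_on D (\<lambda>x. f x - b)"
  have O: "open \<Omega>" using \<Omega> by (simp add: convex_polygonal_domain_def)
  have bO: "bounded \<Omega>"
    using \<Omega> polytope_imp_bounded[of "closure \<Omega>"] bounded_subset[OF _ closure_subset]
    by (simp add: convex_polygonal_domain_def)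
  note pT = mesh_element_polytope[OF mesh T]
  have bT: "bounded T" and cT: "convex T" using pT(1) polytope_imp_bounded polytope_imp_convex by auto
  note sub = interior_mesh_element[OF \<Omega> mesh T, folded D_def]
  have m: "D \<in> sets lebesgue" "\<Omega> \<in> sets lebesgue" using O by (auto simp: D_def)
  note Dl = pT(3)[folded D_def]
  have h: "h > 0"
  proof -
    have "aff_dim T = 2" using mesh T by (auto simp: mesh_of_def aff_dim_simplex)
    then have "\<not> (T = {} \<or> (\<exists>a. T = {a}))" by auto
    then obtain x y where "x \<in> T" "y \<in> T" "x \<noteq> y" by blast
    then have "0 < dist x y" "dist x y \<le> h" using diameter_bounded_bound[OF bT] by (auto simp: h_def)
    then show ?thesis by linarith
  qed
  have hd: "h \<le> d"
  proof -
    have "T \<subseteq> closure \<Omega>" using mesh T by (auto simp: mesh_of_def)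
    then show ?thesis using diameter_subset[of T "closure \<Omega>"] bounded_closure[OF bO] bO by (simp add: h_def d_def diameter_closure)
  qed
  obtain x0 \<rho> where \<rho>: "\<rho> > 0" "cube x0 \<rho> \<subseteq> interior T" "h \<le> 8 * \<sigma> * \<rho>" "\<rho> \<le> h"
    using shape_regular_cube[OF reg \<sigma> h[unfolded h_def] bT, folded h_def] by metis
  have sfb: "square_integrable D (\<lambda>x. f x - b)" and sfc: "square_integrable D (\<lambda>x. f x - c)"
    by (intro square_integrable_diff square_integrable_subset[OF sub m f] square_integrable_const Dl)+
  have sug: "square_integrable D (\<lambda>x. weak_gradient \<Omega> u x - g)"
    using has_weak_gradient_weak_gradient[OF u]
    by (intro square_integrable_diff square_integrable_subset[OF sub m] square_integrable_const Dl) (simp add: has_weak_gradient_def)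
  have cong: "L2_norm_on T v = L2_norm_on T w" if "\<And>x. x \<in> T \<Longrightarrow> v x = w x" for v w :: "plane \<Rightarrow> real"
    unfolding L2_norm_on_def using that by (intro arg_cong[of _ _ sqrt] Bochner_Integration.integral_cong) auto
  note toD = L2_norm_on_interior[OF cT pT(2), folded D_def]
  have eN: "L2_norm_on T (\<lambda>x. weak_gradient \<Omega> u x - g) = N" unfolding N_def by (rule toD[OF sug])
  have eF: "L2_norm_on T (\<lambda>x. f x - \<mu> T x) = L2_norm_on D (\<lambda>x. f x - c)"
    using cong[of "\<lambda>x. f x - \<mu> T x" "\<lambda>x. f x - c"] c toD[OF sfc] by simp
  have eP: "L2_norm_on T (\<lambda>x. f x - fbar T x) = P"
    using cong[of "\<lambda>x. f x - fbar T x" "\<lambda>x. f x - b"] b toD[OF sfb] by (simp add: P_def)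
  have eO: "(oscillation f fbar T)\<^sup>2 = (h * P)\<^sup>2"
    by (simp add: oscillation_def eP h_def power_mult_distrib)
  have nn: "0 \<le> S" "0 \<le> P" "0 \<le> N" by (simp_all add: S_def P_def N_def L2_norm_on_nonneg)
  have split: "(L2_norm_on D (\<lambda>x. f x - c))\<^sup>2 \<le> 2 * P\<^sup>2 + 2 * k\<^sup>2 * measure lebesgue D"
  proof -
    have i1: "integrable (lebesgue_on D) (\<lambda>x. 2 * (norm (f x - b))\<^sup>2)" using sfb by (simp add: square_integrable_def)
    have i2: "integrable (lebesgue_on D) (\<lambda>x. 2 * k\<^sup>2)"
      by (rule finite_measure.integrable_const[OF finite_measure_lebesgue_on[OF Dl]])
    have "(L2_norm_on D (\<lambda>x. f x - c))\<^sup>2 \<le> (LINT x|lebesgue_on D. 2 * (norm (f x - b))\<^sup>2 + 2 * k\<^sup>2)"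
      unfolding L2_norm_on_square
    proof (rule integral_mono)
      show "integrable (lebesgue_on D) (\<lambda>x. (norm (f x - c))\<^sup>2)" using sfc by (simp add: square_integrable_def)
      show "(norm (f x - c))\<^sup>2 \<le> 2 * (norm (f x - b))\<^sup>2 + 2 * k\<^sup>2" for x
      proof -
        have "(norm (f x - c))\<^sup>2 = ((f x - b) + k)\<^sup>2" by (simp add: k_def)
        also have "\<dots> \<le> 2 * (norm (f x - b))\<^sup>2 + 2 * k\<^sup>2"
          unfolding power2_sum real_norm_def power2_abs using sum_squares_bound[of "f x - b" k] by linarith
        finally show ?thesis .
      qed
    qed (intro Bochner_Integration.integrable_add i1 i2)
    also have "\<dots> = 2 * P\<^sup>2 + 2 * k\<^sup>2 * measure lebesgue D"
    proof -
      have "(LINT x|lebesgue_on D. 2 * (norm (f x - b))\<^sup>2 + 2 * k\<^sup>2)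
          = (LINT x|lebesgue_on D. 2 * (norm (f x - b))\<^sup>2) + (LINT x|lebesgue_on D. 2 * k\<^sup>2)"
        by (rule Bochner_Integration.integral_add[OF i1 i2])
      then show ?thesis using m by (simp add: P_def L2_norm_on_square measure_restrict_space)
    qed
    finally show ?thesis .
  qed
  have kb: "(\<bar>k\<bar> * \<rho>\<^sup>2)\<^sup>2 \<le> 3 * (exp 8 * K)\<^sup>2 * (S\<^sup>2 + N\<^sup>2 + (h * P)\<^sup>2)"
  proof -
    have "\<bar>k\<bar> * (exp (- 8) * \<rho>\<^sup>2) \<le> (2 * \<rho> + 16) * (S + N) + 2 * \<rho> * P"
      unfolding k_def S_def N_def P_def D_def by (rule constant_residual_bound[OF \<Omega> mesh T f u _ \<rho>(1,2)]) (rule c)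
    also have "\<dots> \<le> K * (S + N) + K * (h * P)"
    proof (rule add_mono)
      show "(2 * \<rho> + 16) * (S + N) \<le> K * (S + N)"
        using nn \<rho>(4) hd by (intro mult_right_mono) (auto simp: K_def)
      have "2 * \<rho> * P \<le> 2 * h * P" using nn \<rho>(4) by (intro mult_right_mono) auto
      \<comment> \<open>\<open>K \<ge> 2\<close>\<close>
      also have "\<dots> \<le> K * (h * P)"
        using mult_right_mono[of 2 K "h * P"] nn h hd by (simp add: K_def mult.assoc)
      finally show "2 * \<rho> * P \<le> K * (h * P)" .
    qed
    finally have le: "\<bar>k\<bar> * (exp (- 8) * \<rho>\<^sup>2) \<le> K * (S + N + h * P)" by (simp add: distrib_left)
    have e: "exp 8 * exp (- 8) = (1::real)" by (simp flip: exp_add)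
    have "\<bar>k\<bar> * \<rho>\<^sup>2 = exp 8 * exp (- 8) * (\<bar>k\<bar> * \<rho>\<^sup>2)" by (simp only: e mult_1)
    also have "\<dots> = exp 8 * (\<bar>k\<bar> * (exp (- 8) * \<rho>\<^sup>2))" by (simp only: mult_ac)
    also have "\<dots> \<le> exp 8 * (K * (S + N + h * P))" by (rule mult_left_mono[OF le]) simp
    finally have "\<bar>k\<bar> * \<rho>\<^sup>2 \<le> (exp 8 * K) * (S + N + h * P)" by (simp only: mult.assoc)
    then have "(\<bar>k\<bar> * \<rho>\<^sup>2)\<^sup>2 \<le> ((exp 8 * K) * (S + N + h * P))\<^sup>2" by (rule power_mono) simp
    also have "\<dots> = (exp 8 * K)\<^sup>2 * (S + N + h * P)\<^sup>2" by (simp add: power_mult_distrib)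
    also have "\<dots> \<le> (exp 8 * K)\<^sup>2 * (3 * (S\<^sup>2 + N\<^sup>2 + (h * P)\<^sup>2))"
    proof (rule mult_left_mono)
      show "(S + N + h * P)\<^sup>2 \<le> 3 * (S\<^sup>2 + N\<^sup>2 + (h * P)\<^sup>2)"
        using sum_squares_bound[of S N] sum_squares_bound[of S "h * P"] sum_squares_bound[of N "h * P"]
        by (simp add: power2_eq_square algebra_simps)
    qed simp
    also have "\<dots> = 3 * (exp 8 * K)\<^sup>2 * (S\<^sup>2 + N\<^sup>2 + (h * P)\<^sup>2)" by (simp only: mult_ac)
    finally show ?thesis .
  qed
  have area: "measure lebesgue D \<le> 4 * h\<^sup>2"
  proof -
    obtain x where "x \<in> cube x0 \<rho>" using \<rho>(1) by (auto simp: cube_def mem_box_cart intro!: that[of x0])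
    then have "x \<in> T" using \<rho>(2) interior_subset by blast
    from measure_le_diameter_square[OF bT this] show ?thesis by (simp add: D_def h_def)
  qed
  have h4: "h ^ 4 \<le> 4096 * \<sigma> ^ 4 * \<rho> ^ 4"
    using power_mono[OF \<rho>(3), of 4] h by (simp add: power_mult_distrib)
  have "h\<^sup>2 * (L2_norm_on D (\<lambda>x. f x - c))\<^sup>2 \<le> h\<^sup>2 * (2 * P\<^sup>2 + 2 * k\<^sup>2 * (4 * h\<^sup>2))"
  proof (rule mult_left_mono)
    have "2 * k\<^sup>2 * measure lebesgue D \<le> 2 * k\<^sup>2 * (4 * h\<^sup>2)" by (rule mult_left_mono[OF area]) simp
    then show "(L2_norm_on D (\<lambda>x. f x - c))\<^sup>2 \<le> 2 * P\<^sup>2 + 2 * k\<^sup>2 * (4 * h\<^sup>2)" using split by linarith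
  qed simp
  also have "\<dots> = 2 * (h * P)\<^sup>2 + 8 * k\<^sup>2 * h ^ 4"
    by (simp add: power_mult_distrib distrib_left power2_eq_square power4_eq_xxxx)
  also have "\<dots> \<le> 2 * (h * P)\<^sup>2 + 8 * k\<^sup>2 * (4096 * \<sigma> ^ 4 * \<rho> ^ 4)"
    by (rule add_left_mono[OF mult_left_mono[OF h4]]) simp
  also have "\<dots> = 2 * (h * P)\<^sup>2 + 32768 * \<sigma> ^ 4 * (\<bar>k\<bar> * \<rho>\<^sup>2)\<^sup>2"
  proof -
    have "(\<rho>\<^sup>2)\<^sup>2 = \<rho> ^ 4" by (simp flip: power_mult)
    then show ?thesis by (simp add: power_mult_distrib)
  qed
  also have "\<dots> \<le> 2 * (h * P)\<^sup>2 + 32768 * \<sigma> ^ 4 * (3 * (exp 8 * K)\<^sup>2 * (S\<^sup>2 + N\<^sup>2 + (h * P)\<^sup>2))"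
    by (rule add_left_mono[OF mult_left_mono[OF kb]]) simp
  also have "\<dots> \<le> (2 + 98304 * \<sigma> ^ 4 * (exp 8 * K)\<^sup>2) * (N\<^sup>2 + (h * P)\<^sup>2 + S\<^sup>2)"
  proof -
    have "2 * x + 32768 * s * (3 * e * (a + b + x)) \<le> (2 + 98304 * s * e) * (b + x + a)"
      if "0 \<le> a" "0 \<le> b" for a b x s e :: real
      using that by (simp add: algebra_simps)
    then show ?thesis by simp
  qed
  finally have fin: "h\<^sup>2 * (L2_norm_on D (\<lambda>x. f x - c))\<^sup>2
      \<le> (2 + 98304 * \<sigma> ^ 4 * (exp 8 * K)\<^sup>2) * (N\<^sup>2 + (h * P)\<^sup>2 + S\<^sup>2)" .
  have S2: "(H_minus1_norm (interior T) (\<lambda>v. multiplier \<Omega> f u v - broken_functional \<T> \<mu> v))\<^sup>2 = S\<^sup>2"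
    by (simp only: S_def D_def power2_abs)
  have K: "2 * diameter \<Omega> + 16 = K" by (simp only: K_def d_def)
  show ?thesis unfolding eF eN eO S2 K h_def[symmetric] by (rule fin)
qed

theorem mainTheorem4:
  fixes \<Omega> :: "plane set" and F :: "plane set set set"
  assumes "convex_polygonal_domain \<Omega>"
    and "shape_regular_family \<Omega> F"
  shows "\<exists>C>0. \<forall>f \<psi> u. square_integrable \<Omega> f \<longrightarrow> \<psi> \<in> H2 \<Omega> \<longrightarrow> nonpos_on_boundary \<Omega> \<psi> \<longrightarrow>
    solves_obstacle \<Omega> f \<psi> u \<longrightarrow>
    (\<forall>\<T>\<in>F. \<forall>u\<^sub>h \<mu> fbar. solves_obstacle_h \<Omega> \<T> f \<psi> u\<^sub>h \<longrightarrow>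
       discrete_multiplier \<Omega> \<T> f u\<^sub>h \<mu> \<longrightarrow> L2_projection \<T> f fbar \<longrightarrow>
       (\<forall>T\<in>\<T>.
          (diameter T)\<^sup>2 *
            (L2_norm_on T (\<lambda>x. f x + divergence (\<lambda>_. discrete_weak_gradient \<T> u\<^sub>h T) x - \<mu> T x))\<^sup>2
          \<le> C * ((L2_norm_on T (\<lambda>x. weak_gradient \<Omega> u x - discrete_weak_gradient \<T> u\<^sub>h T))\<^sup>2
                + (oscillation f fbar T)\<^sup>2
                + (H_minus1_norm (interior T)
                     (\<lambda>v. multiplier \<Omega> f u v - broken_functional \<T> \<mu> v))\<^sup>2)))"
proof -
  obtain \<sigma> where \<sigma>: "\<sigma> > 0" and reg: "\<And>\<T> T. \<T> \<in> F \<Longrightarrow> T \<in> \<T> \<Longrightarrow> diameter T \<le> \<sigma> * inradius T"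
    and mesh: "\<And>\<T>. \<T> \<in> F \<Longrightarrow> mesh_of \<Omega> \<T>"
    using assms(2) by (auto simp: shape_regular_family_def)
  have div0: "divergence (\<lambda>_. c) x = 0" for c x
    by (simp add: divergence_def frechet_derivative_const)
  show ?thesis
  proof (intro exI[of _ "2 + 98304 * \<sigma> ^ 4 * (exp 8 * (2 * diameter \<Omega> + 16))\<^sup>2"] conjI allI impI ballI, goal_cases)
    case 1
    show ?case
      by (intro add_pos_nonneg) auto
  next
    case (2 f \<psi> u \<T> u\<^sub>h \<mu> fbar T)
    then have "u \<in> H1 \<Omega>" "\<mu> \<in> W_h \<T>" "fbar \<in> W_h \<T>"
      by (auto simp: solves_obstacle_def admissible_def H10_def discrete_multiplier_def L2_projection_def)
    from efficiency_on_element[OF assms(1) mesh[OF 2(5)] 2(9) 2(1) this reg[OF 2(5,9)] \<sigma>]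
    show ?case by (simp add: div0)
  qed
qed

end
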